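(* Let $n\ge 3$ and $4\le k\le n+2$ be integers such that $W^*(n,k-1)$ is defined and \[ W^*(n,k-1)\le 2n+k-4. \tag{$*$} \] Then \[ I(n,k)=n^2+W^*(n,k-1),\qquad T(n,k)=6n^2+2\big(n^2+W^*(n,k-1)\big). \] Moreover, for $n\ge 3$ and $4\le k\le n+2$, condition $( * )$ holds automatically whenever $W^*(n,k-1)=n+k-3$ (the "high regime") and whenever $W^*(n,k-1)=n+2k-6$ (the "middle regime").
   Context: $W^*(n,m)$ denotes the minimum internal wall length of a tiling of the square $[0,n]^2$ by $m$ axis-aligned rectangles with integer sides (integer corners) and pairwise distinct dimension pairs (unordered pairs $\{a,b\}$ of side lengths); it is defined whenever such a tiling exists. The internal wall length of a tiling is the total length of the boundaries between tiles inside the square (each unit segment separating two tiles counted once). For partitions of the cube $[0,n]^3$ into $k$ axis-aligned boxes with integer corners whose dimension multisets are pairwise distinct: $T(n,k)$ is the minimum total surface area $\sum_{j=1}^k 2(x_jy_j+y_jz_j+z_jx_j)$ of the boxes $x_j\times y_j\times z_j$ over all such partitions, and $I(n,k)$ is the minimum internal interface over all such partitions, where the internal interface of a partition is the total area of the boundary between pieces inside the cube (each unit square separating two pieces counted once). The surface area of a partition with internal interface $I$ is $6n^2+2I$. *)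

theory Defs
  imports "HOL-Analysis.Analysis" "HOL-Library.Multiset"
begin

text \<open>
  Rectangles and boxes with integer corners are given by their side intervals, an interval
  being the pair of its end points. Natural numbers suffice, since everything
  lives in the square or cube with one corner at the origin.
\<close>

type_synonym ivl = "nat \<times> nat"
type_synonym rect = "ivl \<times> ivl"
type_synonym brick = "ivl \<times> ivl \<times> ivl"

definition proper :: "ivl \<Rightarrow> bool" where
  "proper I \<longleftrightarrow> fst I < snd I"

definition len :: "ivl \<Rightarrow> nat" where
  "len I = snd I - fst I"

definition seg :: "ivl \<Rightarrow> real set" where
  "seg I = {real (fst I)..real (snd I)}"

fun rect_region :: "rect \<Rightarrow> (real \<times> real) set" where
  "rect_region (I, J) = seg I \<times> seg J"

fun rect_dims :: "rect \<Rightarrow> nat multiset" where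
  "rect_dims (I, J) = {#len I, len J#}"

fun brick_region :: "brick \<Rightarrow> (real \<times> real \<times> real) set" where
  "brick_region (I, J, K) = seg I \<times> seg J \<times> seg K"

fun brick_dims :: "brick \<Rightarrow> nat multiset" where
  "brick_dims (I, J, K) = {#len I, len J, len K#}"

fun brick_area :: "brick \<Rightarrow> nat" where
  "brick_area (I, J, K) = 2 * (len I * len J + len J * len K + len K * len I)"

text \<open>
  The relation \<open>division_of\<close> admits degenerate intervals, so positive side lengths are
  required separately. For proper intervals the maps \<open>rect_region\<close> and \<open>brick_region\<close> are
  injective, so distinct members of \<open>D\<close> are distinct pieces of the division.
\<close>

definition square_tiling :: "nat \<Rightarrow> nat \<Rightarrow> rect set \<Rightarrow> bool" where
  "square_tiling n m D \<longleftrightarrow>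
     finite D \<and> card D = m \<and>
     (\<forall>(I, J)\<in>D. proper I \<and> proper J) \<and>
     (rect_region ` D) division_of ({0..real n} \<times> {0..real n}) \<and>
     inj_on rect_dims D"

definition cube_partition :: "nat \<Rightarrow> nat \<Rightarrow> brick set \<Rightarrow> bool" where
  "cube_partition n k P \<longleftrightarrow>
     finite P \<and> card P = k \<and>
     (\<forall>(I, J, K)\<in>P. proper I \<and> proper J \<and> proper K) \<and>
     (brick_region ` P) division_of ({0..real n} \<times> {0..real n} \<times> {0..real n}) \<and>
     inj_on brick_dims P"

text \<open>
  Pieces are closed with disjoint interiors, so a unit segment (in the plane) or unit square
  (in space) lies on the boundary between two pieces iff it is contained in both.
\<close>

definition separates :: "'a set \<Rightarrow> 'a set set \<Rightarrow> bool" where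
  "separates X R \<longleftrightarrow> (\<exists>A\<in>R. \<exists>B\<in>R. A \<noteq> B \<and> X \<subseteq> A \<inter> B)"

definition wall_length :: "nat \<Rightarrow> rect set \<Rightarrow> nat" where
  "wall_length n D =
     card {(c, i). 0 < c \<and> c < n \<and> i < n \<and>
       separates (seg (c, c) \<times> seg (i, i + 1)) (rect_region ` D)} +
     card {(c, i). 0 < c \<and> c < n \<and> i < n \<and>
       separates (seg (i, i + 1) \<times> seg (c, c)) (rect_region ` D)}"

definition interface_area :: "nat \<Rightarrow> brick set \<Rightarrow> nat" where
  "interface_area n P =
     card {(c, i, j). 0 < c \<and> c < n \<and> i < n \<and> j < n \<and>
       separates (seg (c, c) \<times> seg (i, i + 1) \<times> seg (j, j + 1)) (brick_region ` P)} +
     card {(c, i, j). 0 < c \<and> c < n \<and> i < n \<and> j < n \<and>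
       separates (seg (i, i + 1) \<times> seg (c, c) \<times> seg (j, j + 1)) (brick_region ` P)} +
     card {(c, i, j). 0 < c \<and> c < n \<and> i < n \<and> j < n \<and>
       separates (seg (i, i + 1) \<times> seg (j, j + 1) \<times> seg (c, c)) (brick_region ` P)}"

text \<open>
  The following minima are meaningful only if a tiling, respectively a partition, of the
  required kind exists; existence has to be stated alongside them.
\<close>

definition W_star :: "nat \<Rightarrow> nat \<Rightarrow> nat" where
  "W_star n m = (LEAST w. \<exists>D. square_tiling n m D \<and> wall_length n D = w)"

definition I_min :: "nat \<Rightarrow> nat \<Rightarrow> nat" where
  "I_min n k = (LEAST a. \<exists>P. cube_partition n k P \<and> interface_area n P = a)"

definition T_min :: "nat \<Rightarrow> nat \<Rightarrow> nat" where
  "T_min n k = (LEAST a. \<exists>P. cube_partition n k P \<and> (\<Sum>b\<in>P. brick_area b) = a)"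

end

theory Submission
  imports Defs
begin

text \<open>
  A division of the cube is encoded by the function \<open>f\<close> that sends each unit cell to the piece
  containing it. Along a line of cells every piece occupies a segment, so the number of interface
  squares met by the line is the number of its pieces minus one
  (\<open>card_labels_line\<close>). Hence the interface orthogonal to the third axis is the sum over all
  columns of that count, the rest of the interface is the sum of the wall lengths of the
  \<open>n\<close> horizontal layers (\<open>iface_layers\<close>), and the total surface area of the pieces is
  \<open>6 n\<^sup>2\<close> plus twice the interface (\<open>surface_area_eq\<close>). It therefore suffices to treat the
  interface.

  Upper bound: put a slab of height \<open>n - 1\<close> below an optimal square tiling of height \<open>1\<close>
  (\<open>slab_over_tiling\<close>). The slab has dimensions \<open>n\<close>, \<open>n\<close>, \<open>n - 1\<close>, none of which is \<open>1\<close>, so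
  the dimensions remain distinct.

  Lower bound: every partition has interface at least \<open>n\<^sup>2 + 2 n + k - 4\<close>, or else it consists of
  one slab and a tiled slab, in which case the tiling gives at least \<open>n\<^sup>2 + W\<^sup>*\<close>
  (\<open>iface_lower_bound\<close>). The basic tool is that a layer with \<open>m \<ge> 2\<close> pieces has wall length at
  least \<open>n + m - 2\<close> (\<open>walls_ge\<close>). There are two cases.

  \<^item> Some axis, say the third, has no piece spanning the cube along it (\<open>iface_ge_axis_unspanned\<close>). Every
    column then contributes at least \<open>1\<close>. The layers that consist of several pieces each contribute
    at least \<open>n + m - 2\<close>; the first and the last such layer, if distinct, supply \<open>2 n\<close> and account
    for the pieces that they meet, and every other piece adds a square beyond those \<open>n\<^sup>2\<close>.
    If there is only one such layer, or none, further slabs supply the missing \<open>n\<close> or \<open>2 n\<close>.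
    The estimate fails only if there is exactly one slab and the first and the last of those layers
    carry the same pieces.

  \<^item> Along each axis some piece spans the cube (\<open>iface_ge_all_axes_spanned\<close>). No layer is then a single
    piece, so the layers give at least \<open>n\<^sup>2\<close>, plus terms that account for the pieces in
    a layer through the first spanning piece and one through the second. The \<open>2 n - 1\<close> columns
    that meet a row of the first or of the second spanning piece contain two different pieces in
    these two layers.
\<close>

section \<open>Labels on lines and squares of cells\<close>

text \<open>
  \<open>changes n f\<close> counts the positions in a line of \<open>n\<close> cells where the label differs from the label
  of the preceding cell. The labels are arbitrary; for a division they are its pieces.
\<close>

definition changes :: "nat \<Rightarrow> (nat \<Rightarrow> 'a) \<Rightarrow> nat" where
  "changes n f = card {c. 0 < c \<and> c < n \<and> f (c - 1) \<noteq> f c}"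

text \<open>
  Each label occupies a segment of the line of \<open>n\<close> cells.
\<close>

definition convex_classes :: "nat \<Rightarrow> (nat \<Rightarrow> 'a) \<Rightarrow> bool" where
  "convex_classes n f \<longleftrightarrow> (\<forall>a b c. a \<le> b \<and> b \<le> c \<and> c < n \<and> f a = f c \<longrightarrow> f b = f a)"

lemma card_labels_line:
  assumes "convex_classes n f" and "0 < n"
  shows "card (f ` {..<n}) = Suc (changes n f)"
  using assms
proof (induction n)
  case (Suc n)
  show ?case
  proof (cases "n = 0")
    case True
    have "changes (Suc 0) f = 0" by (auto simp: changes_def)
    then show ?thesis using True by (simp add: lessThan_Suc)
  next
    case False
    have conv: "convex_classes n f"
      using Suc.prems(1) unfolding convex_classes_def by (meson less_SucI)
    have IH: "card (f ` {..<n}) = Suc (changes n f)"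
      using Suc.IH[OF conv] False by simp
    have im: "f ` {..<Suc n} = insert (f n) (f ` {..<n})"
      by (auto simp: lessThan_Suc)
    have mem: "f n \<in> f ` {..<n} \<longleftrightarrow> f (n - 1) = f n"
    proof
      assume "f n \<in> f ` {..<n}"
      then obtain a where "a < n" "f n = f a" by auto
      then have "f (n - 1) = f a"
        using Suc.prems(1)[unfolded convex_classes_def, rule_format, of a "n - 1" n] by simp
      then show "f (n - 1) = f n" using \<open>f n = f a\<close> by simp
    next
      assume "f (n - 1) = f n"
      then show "f n \<in> f ` {..<n}" using False by (metis diff_less imageI lessThan_iff zero_less_one neq0_conv)
    qed
    have ch: "{c. 0 < c \<and> c < Suc n \<and> f (c - 1) \<noteq> f c} =
        {c. 0 < c \<and> c < n \<and> f (c - 1) \<noteq> f c} \<union> (if f (n - 1) = f n then {} else {n})"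
      using False by (auto simp: less_Suc_eq)
    have "changes (Suc n) f = changes n f + (if f (n - 1) = f n then 0 else 1)"
      unfolding changes_def ch by auto
    then show ?thesis using IH mem unfolding im by (auto simp: card_insert_if)
  qed
qed simp

lemma constant_line_0: "changes n f = 0 \<Longrightarrow> x < n \<Longrightarrow> f x = f 0"
proof (induction x)
  case (Suc x)
  have "finite {c. 0 < c \<and> c < n \<and> f (c - 1) \<noteq> f c}" by simp
  then have "{c. 0 < c \<and> c < n \<and> f (c - 1) \<noteq> f c} = {}" using Suc.prems(1) by (simp add: changes_def)
  then have "f x = f (Suc x)" using Suc.prems(2) by force
  then show ?case using Suc by simp
qed simp

lemma constant_line:
  assumes "changes n f = 0" "x < n" "y < n"
  shows "f x = f y"
  using constant_line_0[OF assms(1)] assms by metis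

text \<open>
  Each label occupies a rectangle in the \<open>n\<close> by \<open>n\<close> square of cells: with two cells it contains
  every cell of the rectangle that they span.
\<close>

definition rect_classes :: "nat \<Rightarrow> (nat \<Rightarrow> nat \<Rightarrow> 'a) \<Rightarrow> bool" where
  "rect_classes n g \<longleftrightarrow> (\<forall>x x' u y y' v. x < n \<and> x' < n \<and> y < n \<and> y' < n \<and> g x y = g x' y' \<and>
     min x x' \<le> u \<and> u \<le> max x x' \<and> min y y' \<le> v \<and> v \<le> max y y' \<longrightarrow> g u v = g x y)"

text \<open>
  The labels that occur on the square of cells.
\<close>

definition labels2 :: "nat \<Rightarrow> (nat \<Rightarrow> nat \<Rightarrow> 'a) \<Rightarrow> 'a set" where
  "labels2 n g = {g x y | x y. x < n \<and> y < n}"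

text \<open>
  The number of pairs of adjacent cells with different labels, that is, the internal wall length.
\<close>

definition walls :: "nat \<Rightarrow> (nat \<Rightarrow> nat \<Rightarrow> 'a) \<Rightarrow> nat" where
  "walls n g = (\<Sum>i<n. changes n (\<lambda>c. g c i)) + (\<Sum>i<n. changes n (\<lambda>c. g i c))"

lemma labels2_image: "labels2 n g = (\<lambda>(x, y). g x y) ` ({..<n} \<times> {..<n})"
  by (auto simp: labels2_def)

lemma finite_labels2 [simp]: "finite (labels2 n g)"
  by (simp add: labels2_image)

lemma labels2_flip: "labels2 n (\<lambda>x y. g y x) = labels2 n g"
  by (auto simp: labels2_def)

lemma walls_flip: "walls n (\<lambda>x y. g y x) = walls n g"
  by (simp add: walls_def)

lemma rect_classesD:
  assumes "rect_classes n g" "g x y = g x' y'" "x < n" "x' < n" "y < n" "y' < n"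
    "min x x' \<le> u" "u \<le> max x x'" "min y y' \<le> v" "v \<le> max y y'"
  shows "g u v = g x y"
  using assms(1)[unfolded rect_classes_def, rule_format, of x x' y y' u v] assms by blast

lemma rect_classes_flip: "rect_classes n g \<Longrightarrow> rect_classes n (\<lambda>x y. g y x)"
  unfolding rect_classes_def by blast

lemma rect_classes_line1:
  assumes g: "rect_classes n g" and i: "i < n"
  shows "convex_classes n (\<lambda>c. g c i)"
  unfolding convex_classes_def
proof (intro allI impI, elim conjE)
  fix a b c
  assume *: "a \<le> b" "b \<le> c" "c < n" "g a i = g c i"
  show "g b i = g a i"
    by (rule rect_classesD[OF g *(4)]) (use * i in auto)
qed

lemma rect_classes_line2:
  assumes g: "rect_classes n g" and i: "i < n"
  shows "convex_classes n (\<lambda>c. g i c)"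
  unfolding convex_classes_def
proof (intro allI impI, elim conjE)
  fix a b c
  assume *: "a \<le> b" "b \<le> c" "c < n" "g i a = g i c"
  show "g i b = g i a"
    by (rule rect_classesD[OF g *(4)]) (use * i in auto)
qed

text \<open>
  The walls orthogonal to the first axis number at least the labels absent from the line of cells
  with first coordinate \<open>0\<close>; the walls orthogonal to the second axis supply the labels on that line
  minus one, and at least one wall for each of the other \<open>n - 1\<close> lines.
\<close>

lemma walls_ge_crossed:
  assumes g: "rect_classes n g" and "0 < n"
    and crossed: "\<And>i. i < n \<Longrightarrow> changes n (\<lambda>c. g i c) \<noteq> 0"
  shows "n + card (labels2 n g) \<le> walls n g + 2"
proof -
  define L0 where "L0 = (\<lambda>c. g 0 c) ` {..<n}"
  define row where "row i = (\<lambda>c. g c i) ` {..<n}" for i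
  have "L0 \<subseteq> labels2 n g" using \<open>0 < n\<close> by (auto simp: L0_def labels2_def)
  have "card (labels2 n g - L0) \<le> card (\<Union>i<n. row i - {g 0 i})"
    by (rule card_mono) (auto simp: row_def L0_def labels2_def)
  also have "\<dots> \<le> (\<Sum>i<n. card (row i - {g 0 i}))"
    by (rule card_UN_le) simp
  also have "\<dots> = (\<Sum>i<n. changes n (\<lambda>c. g c i))"
  proof (rule sum.cong)
    fix i assume "i \<in> {..<n}"
    then have "card (row i) = Suc (changes n (\<lambda>c. g c i))"
      unfolding row_def using card_labels_line[OF rect_classes_line1[OF g]] \<open>0 < n\<close> by auto
    moreover have "g 0 i \<in> row i" "finite (row i)" using \<open>0 < n\<close> by (auto simp: row_def)
    ultimately show "card (row i - {g 0 i}) = changes n (\<lambda>c. g c i)" by simp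
  qed simp
  finally have 1: "card (labels2 n g - L0) \<le> (\<Sum>i<n. changes n (\<lambda>c. g c i))" .
  have "card L0 = Suc (changes n (\<lambda>c. g 0 c))"
    unfolding L0_def by (rule card_labels_line[OF rect_classes_line2[OF g]]) (use \<open>0 < n\<close> in auto)
  have "(\<Sum>i<n. changes n (\<lambda>c. g i c)) =
      changes n (\<lambda>c. g 0 c) + (\<Sum>i\<in>{..<n} - {0}. changes n (\<lambda>c. g i c))"
    using \<open>0 < n\<close> by (intro sum.remove) auto
  moreover have "(\<Sum>i\<in>{..<n} - {0}. changes n (\<lambda>c. g i c)) \<ge> (\<Sum>i\<in>{..<n} - {0}. 1)"
    by (rule sum_mono) (use crossed in \<open>force simp: Suc_le_eq\<close>)
  moreover have "(\<Sum>i\<in>{..<n} - {0}. 1) = n - 1" using \<open>0 < n\<close> by simp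
  moreover have "card (labels2 n g) = card (labels2 n g - L0) + card L0"
    using \<open>L0 \<subseteq> labels2 n g\<close> finite_subset[OF \<open>L0 \<subseteq> labels2 n g\<close>]
    by (metis card_Diff_subset card_mono finite_labels2 le_add_diff_inverse2)
  ultimately show ?thesis using 1 \<open>card L0 = _\<close> \<open>0 < n\<close> unfolding walls_def by linarith
qed

text \<open>
  If one line without walls existed in each direction, both would lie in the rectangle of the label
  of their common cell, which would then be the whole square. So one direction is crossed everywhere.
\<close>

lemma walls_ge:
  assumes g: "rect_classes n g" and two: "2 \<le> card (labels2 n g)"
  shows "n + card (labels2 n g) \<le> walls n g + 2"
proof -
  have "0 < n" using two by (cases n) (auto simp: labels2_def)
  show ?thesis
  proof (cases "\<forall>i<n. changes n (\<lambda>c. g i c) \<noteq> 0")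
    case True
    then show ?thesis using walls_ge_crossed[OF g \<open>0 < n\<close>] by blast
  next
    case False
    then obtain i where i: "i < n" "changes n (\<lambda>c. g i c) = 0" by auto
    have "changes n (\<lambda>c. g c j) \<noteq> 0" if "j < n" for j
    proof
      assume j: "changes n (\<lambda>c. g c j) = 0"
      have "g x y = g i j" if "x < n" "y < n" for x y
      proof -
        have a: "g x j = g i y"
          using constant_line[OF i(2), of y j] constant_line[OF j, of x i] that i(1) \<open>j < n\<close> by simp
        have "g x y = g x j"
          by (rule rect_classesD[OF g a]) (use that i \<open>j < n\<close> in auto)
        then show ?thesis using constant_line[OF j, of x i] that i(1) by simp
      qed
      then have "labels2 n g \<subseteq> {g i j}" by (auto simp: labels2_def)
      then have "card (labels2 n g) \<le> 1" using card_mono[of "{g i j}"] by force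
      then show False using two by simp
    qed
    then have "n + card (labels2 n (\<lambda>x y. g y x)) \<le> walls n (\<lambda>x y. g y x) + 2"
      using walls_ge_crossed[OF rect_classes_flip[OF g] \<open>0 < n\<close>] by blast
    then show ?thesis using labels2_flip[of n g] walls_flip[of n g] by simp
  qed
qed

section \<open>Labels on the cube of cells\<close>

text \<open>
  Each label occupies a box in the cube of \<open>n\<^sup>3\<close> cells.
\<close>

definition box_classes :: "nat \<Rightarrow> (nat \<Rightarrow> nat \<Rightarrow> nat \<Rightarrow> 'a) \<Rightarrow> bool" where
  "box_classes n f \<longleftrightarrow> (\<forall>x x' u y y' v z z' w.
     x < n \<and> x' < n \<and> y < n \<and> y' < n \<and> z < n \<and> z' < n \<and> f x y z = f x' y' z' \<and>
     min x x' \<le> u \<and> u \<le> max x x' \<and> min y y' \<le> v \<and> v \<le> max y y' \<and>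
     min z z' \<le> w \<and> w \<le> max z z' \<longrightarrow> f u v w = f x y z)"

text \<open>
  The labels that occur on the cube of cells.
\<close>

definition labels3 :: "nat \<Rightarrow> (nat \<Rightarrow> nat \<Rightarrow> nat \<Rightarrow> 'a) \<Rightarrow> 'a set" where
  "labels3 n f = {f x y z | x y z. x < n \<and> y < n \<and> z < n}"

text \<open>
  The number of pairs of adjacent cells with different labels, that is, the internal interface.
\<close>

definition iface :: "nat \<Rightarrow> (nat \<Rightarrow> nat \<Rightarrow> nat \<Rightarrow> 'a) \<Rightarrow> nat" where
  "iface n f = (\<Sum>i<n. \<Sum>j<n. changes n (\<lambda>c. f c i j)) +
     (\<Sum>i<n. \<Sum>j<n. changes n (\<lambda>c. f i c j)) + (\<Sum>i<n. \<Sum>j<n. changes n (\<lambda>c. f i j c))"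

text \<open>
  The side lengths of the rectangle or box occupied by a label, as the sizes of its coordinate
  projections; as multisets they do not depend on the order of the axes.
\<close>

definition dims2 :: "nat \<Rightarrow> (nat \<Rightarrow> nat \<Rightarrow> 'a) \<Rightarrow> 'a \<Rightarrow> nat multiset" where
  "dims2 n g a = {#card {x. x < n \<and> (\<exists>y<n. g x y = a)}, card {y. y < n \<and> (\<exists>x<n. g x y = a)}#}"

definition dims3 :: "nat \<Rightarrow> (nat \<Rightarrow> nat \<Rightarrow> nat \<Rightarrow> 'a) \<Rightarrow> 'a \<Rightarrow> nat multiset" where
  "dims3 n f a = {#card {x. x < n \<and> (\<exists>y<n. \<exists>z<n. f x y z = a)},
     card {y. y < n \<and> (\<exists>x<n. \<exists>z<n. f x y z = a)},
     card {z. z < n \<and> (\<exists>x<n. \<exists>y<n. f x y z = a)}#}"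

lemma labels3_image: "labels3 n f = (\<lambda>(x, y, z). f x y z) ` ({..<n} \<times> {..<n} \<times> {..<n})"
  by (force simp: labels3_def)

lemma finite_labels3 [simp]: "finite (labels3 n f)"
  by (simp add: labels3_image)

lemma box_classesD:
  assumes "box_classes n f" "f x y z = f x' y' z'" "x < n" "x' < n" "y < n" "y' < n" "z < n" "z' < n"
    "min x x' \<le> u" "u \<le> max x x'" "min y y' \<le> v" "v \<le> max y y'" "min z z' \<le> w" "w \<le> max z z'"
  shows "f u v w = f x y z"
  using assms(1)[unfolded box_classes_def, rule_format, of x x' y y' z z' u v w] assms by blast

lemma box_classes_rotate: "box_classes n f \<Longrightarrow> box_classes n (\<lambda>x y z. f y z x)"
  unfolding box_classes_def by blast

lemma labels3_rotate: "labels3 n (\<lambda>x y z. f y z x) = labels3 n f"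
  unfolding labels3_def by blast

lemma iface_rotate: "iface n (\<lambda>x y z. f y z x) = iface n f"
proof -
  have "(\<Sum>i<n. \<Sum>j<n. changes n (\<lambda>c. f c j i)) = (\<Sum>i<n. \<Sum>j<n. changes n (\<lambda>c. f c i j))"
    by (rule sum.swap)
  moreover have "(\<Sum>i<n. \<Sum>j<n. changes n (\<lambda>c. f j c i)) = (\<Sum>i<n. \<Sum>j<n. changes n (\<lambda>c. f i c j))"
    by (rule sum.swap)
  ultimately show ?thesis by (simp add: iface_def)
qed

lemma dims3_rotate: "dims3 n (\<lambda>x y z. f y z x) = dims3 n f"
proof
  fix a
  have 2: "{y. y < n \<and> (\<exists>x<n. \<exists>z<n. f y z x = a)} = {x. x < n \<and> (\<exists>y<n. \<exists>z<n. f x y z = a)}"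
    by auto
  have 3: "{z. z < n \<and> (\<exists>x<n. \<exists>y<n. f y z x = a)} = {y. y < n \<and> (\<exists>x<n. \<exists>z<n. f x y z = a)}"
    by auto
  show "dims3 n (\<lambda>x y z. f y z x) a = dims3 n f a"
    unfolding dims3_def 2 3 by (simp add: add_mset_commute)
qed

lemma box_classes_layer:
  assumes f: "box_classes n f" and h: "h < n"
  shows "rect_classes n (\<lambda>x y. f x y h)"
  unfolding rect_classes_def
proof (intro allI impI, elim conjE)
  fix x x' u y y' v
  assume *: "x < n" "x' < n" "y < n" "y' < n" "f x y h = f x' y' h"
    "min x x' \<le> u" "u \<le> max x x'" "min y y' \<le> v" "v \<le> max y y'"
  show "f u v h = f x y h"
    by (rule box_classesD[OF f *(5) *(1-4) h h *(6-9)]) simp_all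
qed

lemma box_classes_column:
  assumes f: "box_classes n f" and ij: "i < n" "j < n"
  shows "convex_classes n (\<lambda>c. f i j c)"
  unfolding convex_classes_def
proof (intro allI impI, elim conjE)
  fix a b c
  assume *: "a \<le> b" "b \<le> c" "c < n" "f i j a = f i j c"
  show "f i j b = f i j a"
    by (rule box_classesD[OF f *(4)]) (use * ij in auto)
qed

lemma iface_layers:
  "iface n f = (\<Sum>h<n. walls n (\<lambda>x y. f x y h)) + (\<Sum>i<n. \<Sum>j<n. changes n (\<lambda>c. f i j c))"
proof -
  have "(\<Sum>h<n. walls n (\<lambda>x y. f x y h)) =
    (\<Sum>h<n. \<Sum>i<n. changes n (\<lambda>c. f c i h)) + (\<Sum>h<n. \<Sum>i<n. changes n (\<lambda>c. f i c h))"
    by (simp add: walls_def sum.distrib)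
  then show ?thesis
    unfolding iface_def
    by (subst (asm) (1 2) sum.swap) simp
qed

section \<open>A spanning piece along each axis\<close>

lemma trivial_layer:
  assumes "\<not> 2 \<le> card (labels2 n g)" "x < n" "y < n" "x' < n" "y' < n"
  shows "g x y = g x' y'"
proof -
  have "card (labels2 n g) \<le> Suc 0" using assms(1) by simp
  then have "\<forall>a\<in>labels2 n g. \<forall>b\<in>labels2 n g. a = b"
    by (simp add: card_le_Suc0_iff_eq)
  then show ?thesis using assms(2-) unfolding labels2_def by blast
qed

lemma card_column_le:
  assumes f: "box_classes n f" and ij: "i < n" "j < n" and X: "X \<subseteq> (\<lambda>c. f i j c) ` {..<n}"
  shows "card X \<le> Suc (changes n (\<lambda>c. f i j c))"
proof -
  have "card X \<le> card ((\<lambda>c. f i j c) ` {..<n})" by (rule card_mono[OF _ X]) simp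
  also have "\<dots> = Suc (changes n (\<lambda>c. f i j c))"
    by (rule card_labels_line[OF box_classes_column[OF f ij]]) (use ij in simp)
  finally show ?thesis .
qed

lemma card_le_sum_columns:
  assumes R: "R \<subseteq> labels3 n f"
  shows "card R \<le> (\<Sum>i<n. \<Sum>j<n. card (R \<inter> (\<lambda>c. f i j c) ` {..<n}))"
proof -
  have "finite R" using R finite_subset finite_labels3 by blast
  have "R \<subseteq> (\<Union>i<n. \<Union>j<n. R \<inter> (\<lambda>c. f i j c) ` {..<n})"
  proof
    fix a assume "a \<in> R"
    then obtain x y z where *: "x < n" "y < n" "z < n" "a = f x y z"
      using R unfolding labels3_def by blast
    then have "a \<in> R \<inter> (\<lambda>c. f x y c) ` {..<n}" using \<open>a \<in> R\<close> by simp
    then show "a \<in> (\<Union>i<n. \<Union>j<n. R \<inter> (\<lambda>c. f i j c) ` {..<n})" using * by blast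
  qed
  then have "card R \<le> card (\<Union>i<n. \<Union>j<n. R \<inter> (\<lambda>c. f i j c) ` {..<n})"
    by (rule card_mono[rotated]) (use \<open>finite R\<close> in simp)
  also have "\<dots> \<le> (\<Sum>i<n. card (\<Union>j<n. R \<inter> (\<lambda>c. f i j c) ` {..<n}))"
    by (rule card_UN_le) simp
  also have "\<dots> \<le> (\<Sum>i<n. \<Sum>j<n. card (R \<inter> (\<lambda>c. f i j c) ` {..<n}))"
    by (rule sum_mono, rule card_UN_le) simp
  finally show ?thesis .
qed

text \<open>
  The case in which along each axis some piece spans the cube. The premises on \<open>changes\<close> name a line
  of cells inside each of the spanning pieces. The layers \<open>z0\<close> and \<open>z1\<close> contain the lines along
  the first and the second axis. Since the piece spanning the third axis lies in both, at most
  \<open>m z0 + m z1 - 1\<close> pieces meet these two layers; \<open>R\<close> consists of the other pieces.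
\<close>

lemma iface_ge_all_axes_spanned:
  assumes f: "box_classes n f" and two: "2 \<le> card (labels3 n f)"
    and X: "y0 < n" "z0 < n" "changes n (\<lambda>c. f c y0 z0) = 0"
    and Y: "x1 < n" "z1 < n" "changes n (\<lambda>c. f x1 c z1) = 0"
    and Z: "x2 < n" "y2 < n" "changes n (\<lambda>c. f x2 y2 c) = 0"
  shows "n\<^sup>2 + 2 * n + card (labels3 n f) \<le> iface n f + 4"
proof -
  define m where "m h = card (labels2 n (\<lambda>x y. f x y h))" for h
  define L0 where "L0 = labels2 n (\<lambda>x y. f x y z0)"
  define L1 where "L1 = labels2 n (\<lambda>x y. f x y z1)"
  define R where "R = labels3 n f - (L0 \<union> L1)"
  define r where "r i j = card (R \<inter> (\<lambda>c. f i j c) ` {..<n})" for i j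
  \<comment> \<open>A layer consisting of a single piece would meet the piece that spans the third axis.\<close>
  have nontrivial: "2 \<le> m h" if h: "h < n" for h
  proof (rule ccontr)
    assume *: "\<not> 2 \<le> m h"
    have const: "f x y h = f x2 y2 h" if "x < n" "y < n" for x y
      using trivial_layer[OF *[unfolded m_def]] that Z by blast
    have "f x y z = f x2 y2 h" if "x < n" "y < n" "z < n" for x y z
    proof -
      have e: "f x y h = f x2 y2 z"
        using const[OF that(1,2)] constant_line[OF Z(3) h that(3)] by simp
      have "f x y z = f x y h"
        by (rule box_classesD[OF f e]) (use that Z h in auto)
      then show ?thesis using const that by simp
    qed
    then have "labels3 n f \<subseteq> {f x2 y2 h}" by (auto simp: labels3_def)
    then have "card (labels3 n f) \<le> 1" using card_mono[of "{f x2 y2 h}"] by force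
    then show False using two by simp
  qed
  have walls: "n + m h \<le> walls n (\<lambda>x y. f x y h) + 2" if "h < n" for h
    unfolding m_def
    by (rule walls_ge[OF box_classes_layer[OF f that]]) (use nontrivial[OF that] in \<open>simp add: m_def\<close>)
  \<comment> \<open>A piece spanning both horizontal axes would fill a layer.\<close>
  have skew: "f x y0 z0 \<noteq> f x1 y z1" if "x < n" "y < n" for x y
  proof
    assume eq: "f x y0 z0 = f x1 y z1"
    have "f u v z0 = f x y0 z0" if "u < n" "v < n" for u v
    proof -
      have e: "f u y0 z0 = f x1 v z1"
        using eq constant_line[OF X(3), of u x] constant_line[OF Y(3), of v y]
          \<open>x < n\<close> \<open>y < n\<close> that by simp
      have "f u v z0 = f u y0 z0"
        by (rule box_classesD[OF f e]) (use that X Y in auto)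
      then show ?thesis using constant_line[OF X(3), of u x] \<open>x < n\<close> that by simp
    qed
    then have "labels2 n (\<lambda>x y. f x y z0) \<subseteq> {f x y0 z0}" by (auto simp: labels2_def)
    then have "m z0 \<le> 1" using card_mono[of "{f x y0 z0}"] by (force simp: m_def)
    then show False using nontrivial[OF X(2)] by simp
  qed
  have "z0 \<noteq> z1" using skew[of x1 y0] X Y by auto

  have fin: "finite R" "finite L0" "finite L1" by (auto simp: R_def L0_def L1_def)
  \<comment> \<open>On the cross \<open>j = y0 \<or> i = x1\<close> the layers \<open>z0\<close> and \<open>z1\<close> show different pieces.\<close>
  have column: "of_bool (j = y0 \<or> i = x1) + r i j \<le> changes n (\<lambda>c. f i j c)"
    if ij: "i < n" "j < n" for i j
  proof -
    let ?E = "{f i j z0, f i j z1}"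
    have "card (?E \<union> (R \<inter> (\<lambda>c. f i j c) ` {..<n})) \<le> Suc (changes n (\<lambda>c. f i j c))"
      by (rule card_column_le[OF f ij]) (use X Y in auto)
    moreover have "?E \<inter> R = {}"
      using ij X Y by (auto simp: R_def L0_def L1_def labels2_def)
    then have "card (?E \<union> (R \<inter> (\<lambda>c. f i j c) ` {..<n})) = card ?E + r i j"
      unfolding r_def using fin by (subst card_Un_disjoint) auto
    moreover have "Suc (of_bool (j = y0 \<or> i = x1)) \<le> card ?E"
    proof -
      have "f i j z0 \<noteq> f i j z1" if "j = y0 \<or> i = x1"
        using that
      proof
        assume "j = y0"
        moreover have "f i y0 z0 = f x1 y0 z0" using constant_line[OF X(3), of i x1] ij Y by simp
        moreover have "f i y0 z0 \<noteq> f i y0 z1"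
        proof
          assume e: "f i y0 z0 = f i y0 z1"
          have e': "f i y0 z1 = f x1 y0 z0" using e \<open>f i y0 z0 = f x1 y0 z0\<close> by simp
          have "f x1 y0 z1 = f i y0 z1"
            by (rule box_classesD[OF f e']) (use ij X Y in auto)
          then show False using skew[of i y0] ij X e by simp
        qed
        ultimately show ?thesis by simp
      next
        assume "i = x1"
        moreover have "f x1 j z0 \<noteq> f x1 j z1"
        proof
          assume e: "f x1 j z0 = f x1 j z1"
          have e': "f x1 j z0 = f x1 y0 z1"
            using e constant_line[OF Y(3), of j y0] ij X by simp
          have "f x1 y0 z0 = f x1 j z0"
            by (rule box_classesD[OF f e']) (use ij X Y in auto)
          then show False using skew[of x1 y0] Y X e' by simp
        qed
        ultimately show ?thesis by simp
      qed
      then show ?thesis by (auto simp: card_insert_if)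
    qed
    ultimately show ?thesis by linarith
  qed
  have "(\<Sum>i<n. \<Sum>j<n. of_bool (j = y0 \<or> i = x1)) = (\<Sum>i<n. if i = x1 then n else 1)"
  proof (rule sum.cong)
    fix i assume "i \<in> {..<n}"
    have "(\<Sum>j<n. of_bool (j = y0)) = (1::nat)"
      using X by (simp add: of_bool_def)
    then show "(\<Sum>j<n. of_bool (j = y0 \<or> i = x1)) = (if i = x1 then n else 1)" by simp
  qed simp
  also have "\<dots> + 1 = 2 * n"
  proof -
    have "(\<Sum>i<n. if i = x1 then n else 1) = n + (\<Sum>i\<in>{..<n} - {x1}. if i = x1 then n else 1)"
      using Y by (subst sum.remove[of _ x1]) auto
    also have "(\<Sum>i\<in>{..<n} - {x1}. if i = x1 then n else 1) = (\<Sum>i\<in>{..<n} - {x1}. 1)"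
      by (rule sum.cong) auto
    also have "\<dots> = n - 1" using Y by simp
    finally show ?thesis using Y by simp
  qed
  finally have cross: "(\<Sum>i<n. \<Sum>j<n. of_bool (j = y0 \<or> i = x1)) + 1 = 2 * n" .
  have "(\<Sum>i<n. \<Sum>j<n. of_bool (j = y0 \<or> i = x1) + r i j) \<le> (\<Sum>i<n. \<Sum>j<n. changes n (\<lambda>c. f i j c))"
    by (intro sum_mono column) auto
  then have "(\<Sum>i<n. \<Sum>j<n. of_bool (j = y0 \<or> i = x1)) + (\<Sum>i<n. \<Sum>j<n. r i j)
      \<le> (\<Sum>i<n. \<Sum>j<n. changes n (\<lambda>c. f i j c))"
    by (simp only: sum.distrib)
  moreover have "card R \<le> (\<Sum>i<n. \<Sum>j<n. r i j)"
    unfolding r_def by (rule card_le_sum_columns) (auto simp: R_def)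
  ultimately have horizontal: "2 * n + card R \<le> (\<Sum>i<n. \<Sum>j<n. changes n (\<lambda>c. f i j c)) + 1"
    using cross by linarith

  let ?w = "\<lambda>h. walls n (\<lambda>x y. f x y h)"
  have "(\<Sum>h<n. ?w h) = (\<Sum>h\<in>{..<n} - {z0, z1}. ?w h) + (\<Sum>h\<in>{z0, z1}. ?w h)"
    using X Y by (intro sum.subset_diff) auto
  moreover have "(\<Sum>h\<in>{z0, z1}. ?w h) = ?w z0 + ?w z1" using \<open>z0 \<noteq> z1\<close> by simp
  moreover have "(\<Sum>h\<in>{..<n} - {z0, z1}. n) \<le> (\<Sum>h\<in>{..<n} - {z0, z1}. ?w h)"
  proof (rule sum_mono)
    fix h assume "h \<in> {..<n} - {z0, z1}"
    then show "n \<le> ?w h" using walls[of h] nontrivial[of h] by simp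
  qed
  moreover have "(\<Sum>h\<in>{..<n} - {z0, z1}. n) = (n - 2) * n"
    using X Y \<open>z0 \<noteq> z1\<close> by (simp add: card_Diff_subset)
  moreover have "2 \<le> n" using X Y \<open>z0 \<noteq> z1\<close> by linarith
  then have "(n - 2) * n + 2 * n = n\<^sup>2"
    by (metis add_mult_distrib le_add_diff_inverse2 power2_eq_square)
  ultimately have vertical: "n\<^sup>2 + m z0 + m z1 \<le> (\<Sum>h<n. ?w h) + 4"
    using walls[OF X(2)] walls[OF Y(2)] by linarith

  have "f x2 y2 z0 \<in> L0" using X Z by (auto simp: L0_def labels2_def)
  moreover have "f x2 y2 z0 = f x2 y2 z1" using constant_line[OF Z(3), of z0 z1] X Y by simp
  then have "f x2 y2 z0 \<in> L1" using Y Z by (auto simp: L1_def labels2_def)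
  ultimately have "card (L0 \<inter> L1) \<noteq> 0" using fin by auto
  moreover have "card L0 + card L1 = card (L0 \<union> L1) + card (L0 \<inter> L1)"
    by (rule card_Un_Int[OF fin(2,3)])
  moreover have "card (labels3 n f) \<le> card (L0 \<union> L1) + card R"
  proof -
    have "labels3 n f \<subseteq> (L0 \<union> L1) \<union> R" unfolding R_def by blast
    then have "card (labels3 n f) \<le> card ((L0 \<union> L1) \<union> R)"
      by (rule card_mono[rotated]) (simp add: fin)
    then show ?thesis using card_Un_le order_trans by blast
  qed
  ultimately have "card (labels3 n f) + 1 \<le> m z0 + m z1 + card R"
    unfolding m_def L0_def[symmetric] L1_def[symmetric] by linarith
  then show ?thesis using horizontal vertical unfolding iface_layers[of n f] by linarith
qed

section \<open>No spanning piece along one axis\<close>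

text \<open>
  The case in which every column meets at least two pieces. \<open>N\<close> is the set of layers with at least
  two pieces and \<open>S\<close> the set of slabs, the pieces that fill a whole layer. With \<open>h1\<close> and \<open>h2\<close>
  the first and the last layer in \<open>N\<close>, a column contains all slabs, its pieces in the layers
  \<open>h1\<close> and \<open>h2\<close> (which differ iff \<open>d i j = 1\<close>), and its \<open>r i j\<close> remaining pieces, collected
  over all columns in \<open>R\<close>. The second alternative of the conclusion is the slab together with
  the tiling seen in layer \<open>h1\<close>.
\<close>

lemma iface_ge_axis_unspanned:
  fixes f :: "nat \<Rightarrow> nat \<Rightarrow> nat \<Rightarrow> 'a"
  assumes f: "box_classes n f" and n: "2 \<le> n" and four: "4 \<le> card (labels3 n f)"
    and cover: "\<And>i j. i < n \<Longrightarrow> j < n \<Longrightarrow> changes n (\<lambda>c. f i j c) \<noteq> 0"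
  shows "n\<^sup>2 + 2 * n + card (labels3 n f) \<le> iface n f + 4 \<or>
    (\<exists>g :: nat \<Rightarrow> nat \<Rightarrow> 'a. rect_classes n g \<and> card (labels2 n g) + 1 = card (labels3 n f) \<and>
      n\<^sup>2 + walls n g \<le> iface n f \<and>
      (inj_on (dims3 n f) (labels3 n f) \<longrightarrow> inj_on (dims2 n g) (labels2 n g)))"
proof -
  define m where "m h = card (labels2 n (\<lambda>x y. f x y h))" for h
  define N where "N = {h. h < n \<and> 2 \<le> m h}"
  define S where "S = {a. \<exists>h<n. \<forall>x<n. \<forall>y<n. f x y h = a}"
  let ?w = "\<lambda>h. walls n (\<lambda>x y. f x y h)"
  let ?col = "\<lambda>i j. (\<lambda>c. f i j c) ` {..<n}"
  let ?I = "\<Sum>i<n. \<Sum>j<n. changes n (\<lambda>c. f i j c)"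
  have S_col: "S \<subseteq> ?col i j" if "i < n" "j < n" for i j
    using that unfolding S_def by blast
  have S_labels: "S \<subseteq> labels3 n f"
    using n unfolding S_def labels3_def by force
  have finS: "finite S" using S_labels finite_subset finite_labels3 by blast
  have trivial: "f x y h \<in> S" if h: "h < n" "h \<notin> N" and xy: "x < n" "y < n" for h x y
  proof -
    have "\<not> 2 \<le> m h" using h by (simp add: N_def)
    then have "\<forall>u<n. \<forall>v<n. f u v h = f x y h"
      unfolding m_def using trivial_layer[of n "\<lambda>x y. f x y h"] xy by blast
    then show ?thesis using h unfolding S_def by blast
  qed
  have slab: "f x y h \<notin> S" if h: "h \<in> N" and xy: "x < n" "y < n" for h x y
  proof
    assume "f x y h \<in> S"
    then obtain h' where h': "h' < n" "\<And>u v. u < n \<Longrightarrow> v < n \<Longrightarrow> f u v h' = f x y h"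
      unfolding S_def by blast
    have hn: "h < n" using h by (simp add: N_def)
    have "f u v h = f x y h" if uv: "u < n" "v < n" for u v
    proof -
      have e: "f u v h' = f x y h" using h'(2) uv by blast
      have "f u v h = f u v h'" by (rule box_classesD[OF f e]) (use uv xy hn h' in auto)
      then show ?thesis using e by simp
    qed
    then have "labels2 n (\<lambda>x y. f x y h) \<subseteq> {f x y h}" by (auto simp: labels2_def)
    then have "m h \<le> 1" using card_mono[of "{f x y h}"] by (force simp: m_def)
    then show False using h by (simp add: N_def)
  qed
  have walls: "n + m h \<le> ?w h + 2" if "h \<in> N" for h
    using that walls_ge[OF box_classes_layer[OF f]] unfolding N_def m_def by simp
  have const_sum: "(\<Sum>i<n. \<Sum>j<n. c) = n\<^sup>2 * c" for c :: nat
    by (simp add: power2_eq_square)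
  have nn: "4 \<le> n\<^sup>2" "n \<le> n\<^sup>2" "2 * n \<le> n\<^sup>2"
    using mult_le_mono[OF n n] n by (auto simp: power2_eq_square)

  show ?thesis
  proof (cases "N = {}")
    case True
    have "labels3 n f \<subseteq> S" using trivial True unfolding labels3_def by blast
    then have "card (labels3 n f) = card S" using S_labels by (simp add: subset_antisym)
    then have "card (labels3 n f) - 1 \<le> changes n (\<lambda>c. f i j c)" if "i < n" "j < n" for i j
      using card_column_le[OF f that S_col[OF that]] by simp
    \<comment> \<open>All pieces are slabs, and every column meets all of them.\<close>
    then have "(\<Sum>i<n. \<Sum>j<n. card (labels3 n f) - 1) \<le> ?I" by (intro sum_mono) auto
    then have I: "n\<^sup>2 * (card (labels3 n f) - 1) \<le> ?I" by (simp only: const_sum)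
    obtain q where q: "card (labels3 n f) = q + 4" using four by (metis le_add_diff_inverse2)
    have "q \<le> n\<^sup>2 * q" using nn(1) by simp
    moreover have "n\<^sup>2 * (q + 3) = n\<^sup>2 * q + 3 * n\<^sup>2" by (simp add: algebra_simps)
    ultimately have "n\<^sup>2 + 2 * n + q \<le> n\<^sup>2 * (q + 3)" using nn by linarith
    moreover have "card (labels3 n f) - 1 = q + 3" using q by simp
    then have "n\<^sup>2 * (q + 3) \<le> ?I" using I by metis
    ultimately show ?thesis using q unfolding iface_layers[of n f] by linarith
  next
    case False
    define h1 where "h1 = Min N"
    define h2 where "h2 = Max N"
    have "finite N" by (simp add: N_def)
    then have h12: "h1 \<in> N" "h2 \<in> N" "h1 \<le> h2" and between: "\<And>h. h \<in> N \<Longrightarrow> h1 \<le> h \<and> h \<le> h2"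
      using False by (auto simp: h1_def h2_def)
    have h12n: "h1 < n" "h2 < n" using h12 by (auto simp: N_def)
    define L1 where "L1 = labels2 n (\<lambda>x y. f x y h1)"
    define L2 where "L2 = labels2 n (\<lambda>x y. f x y h2)"
    define R where "R = labels3 n f - (S \<union> L1 \<union> L2)"
    define r where "r i j = card (R \<inter> ?col i j)" for i j
    define d :: "nat \<Rightarrow> nat \<Rightarrow> nat" where "d i j = of_bool (f i j h1 \<noteq> f i j h2)" for i j
    have fin: "finite R" "finite L1" "finite L2" by (auto simp: R_def L1_def L2_def)
    have column: "card S + d i j + r i j \<le> changes n (\<lambda>c. f i j c)"
      if ij: "i < n" "j < n" for i j
    proof -
      let ?E = "{f i j h1, f i j h2}"
      have "?E \<inter> S = {}" using slab h12 ij by blast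
      have "f i j h1 \<in> L1" "f i j h2 \<in> L2" using ij by (auto simp: L1_def L2_def labels2_def)
      then have "(?E \<union> S) \<inter> (R \<inter> ?col i j) = {}" by (auto simp: R_def)
      then have "card (?E \<union> S \<union> (R \<inter> ?col i j)) = card (?E \<union> S) + r i j"
        unfolding r_def by (rule card_Un_disjoint[rotated 2]) (use fin finS in auto)
      also have "card (?E \<union> S) = card ?E + card S"
        by (rule card_Un_disjoint) (use finS \<open>?E \<inter> S = {}\<close> in auto)
      finally have "card (?E \<union> S \<union> (R \<inter> ?col i j)) = card ?E + card S + r i j" .
      moreover have "card (?E \<union> S \<union> (R \<inter> ?col i j)) \<le> Suc (changes n (\<lambda>c. f i j c))"
        by (rule card_column_le[OF f ij]) (use S_col[OF ij] h12n in auto)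
      moreover have "card ?E = Suc (d i j)" by (simp add: d_def card_insert_if)
      ultimately show ?thesis by linarith
    qed
    \<comment> \<open>A remaining piece of the column lies strictly between \<open>h1\<close> and \<open>h2\<close>.\<close>
    have rd: "d i j = 1" if ij: "i < n" "j < n" and "r i j \<noteq> 0" for i j
    proof (rule ccontr)
      assume "d i j \<noteq> 1"
      then have eq: "f i j h1 = f i j h2" by (simp add: d_def of_bool_def split: if_splits)
      have "R \<inter> ?col i j \<noteq> {}" using \<open>r i j \<noteq> 0\<close> unfolding r_def by (metis card.empty)
      then obtain h where h: "h < n" "f i j h \<in> R" by auto
      then have "h \<in> N" using trivial ij unfolding R_def by blast
      then have b: "h1 \<le> h" "h \<le> h2" using between by auto
      have "f i j h = f i j h1"
        by (rule box_classesD[OF f eq]) (use ij h12n b in auto)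
      then have "f i j h \<in> L1" using ij unfolding L1_def labels2_def by auto
      then show False using h by (simp add: R_def)
    qed
    have cardR: "card R \<le> (\<Sum>i<n. \<Sum>j<n. r i j)"
      unfolding r_def by (rule card_le_sum_columns) (auto simp: R_def)
    have total: "card (labels3 n f) \<le> card S + card (L1 \<union> L2) + card R"
    proof -
      have "labels3 n f \<subseteq> S \<union> (L1 \<union> L2) \<union> R" unfolding R_def by blast
      then have "card (labels3 n f) \<le> card (S \<union> (L1 \<union> L2) \<union> R)"
        by (rule card_mono[rotated]) (simp add: fin finS)
      also have "\<dots> \<le> card (S \<union> (L1 \<union> L2)) + card R" by (rule card_Un_le)
      also have "card (S \<union> (L1 \<union> L2)) \<le> card S + card (L1 \<union> L2)" by (rule card_Un_le)
      finally show ?thesis by simp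
    qed
    have mL: "card L1 = m h1" "card L2 = m h2" by (simp_all add: m_def L1_def L2_def)
    show ?thesis
    proof (cases "card S = 1 \<and> (\<forall>i<n. \<forall>j<n. d i j = 0)")
      case True
      then have same: "f i j h1 = f i j h2" if "i < n" "j < n" for i j
        using that by (auto simp: d_def)
      have "(\<Sum>i<n. \<Sum>j<n. r i j) = 0" using rd True by fastforce
      then have "R = {}" using cardR fin by simp
      have "L2 = L1" using same unfolding L1_def L2_def labels2_def by (metis (no_types, lifting))
      have "S \<inter> L1 = {}" using slab h12 unfolding L1_def labels2_def by blast
      have "S \<union> L1 = labels3 n f"
        using \<open>R = {}\<close> \<open>L2 = L1\<close> S_labels h12n unfolding R_def L1_def labels2_def labels3_def by blast
      then have card: "card L1 + 1 = card (labels3 n f)"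
        using card_Un_disjoint[OF finS fin(2) \<open>S \<inter> L1 = {}\<close>] True by simp
      have "(\<Sum>i<n. \<Sum>j<n. 1) \<le> ?I"
        by (intro sum_mono) (use cover in \<open>force simp: Suc_le_eq\<close>)
      then have "n\<^sup>2 \<le> ?I" by (simp only: const_sum mult_1_right)
      moreover have "?w h1 \<le> (\<Sum>h<n. ?w h)" by (rule member_le_sum) (use h12n in auto)
      ultimately have bound: "n\<^sup>2 + ?w h1 \<le> iface n f" unfolding iface_layers[of n f] by linarith
      define c where "c = card {h1..h2}"
      \<comment> \<open>All pieces of layer \<open>h1\<close> have the same height \<open>c\<close>.\<close>
      have dims: "dims3 n f a = add_mset c (dims2 n (\<lambda>x y. f x y h1) a)" if "a \<in> L1" for a
      proof -
        from that obtain u v where a: "u < n" "v < n" "a = f u v h1"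
          unfolding L1_def labels2_def by blast
        have mem: "f x y h1 = a" if "x < n" "y < n" "z < n" "f x y z = a" for x y z
        proof -
          have e: "f x y z = f u v h1" using that a by simp
          have "f x y h1 = f x y z" by (rule box_classesD[OF f e]) (use that a h12n in auto)
          then show ?thesis using that by simp
        qed
        have X: "{x. x < n \<and> (\<exists>y<n. \<exists>z<n. f x y z = a)} = {x. x < n \<and> (\<exists>y<n. f x y h1 = a)}"
          using mem h12n by blast
        have Y: "{y. y < n \<and> (\<exists>x<n. \<exists>z<n. f x y z = a)} = {y. y < n \<and> (\<exists>x<n. f x y h1 = a)}"
          using mem h12n by blast
        have Z: "{z. z < n \<and> (\<exists>x<n. \<exists>y<n. f x y z = a)} = {h1..h2}"
        proof (intro set_eqI iffI)
          fix z assume "z \<in> {z. z < n \<and> (\<exists>x<n. \<exists>y<n. f x y z = a)}"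
          then obtain x y where z: "z < n" "x < n" "y < n" "f x y z = a" by blast
          have "z \<in> N"
          proof (rule ccontr)
            assume "z \<notin> N"
            then have "a \<in> S" using trivial z by blast
            then show False using \<open>S \<inter> L1 = {}\<close> \<open>a \<in> L1\<close> by blast
          qed
          then show "z \<in> {h1..h2}" using between by simp
        next
          fix z assume z: "z \<in> {h1..h2}"
          have "f u v z = f u v h1"
            by (rule box_classesD[OF f same[OF a(1,2)]]) (use z a h12n in auto)
          then show "z \<in> {z. z < n \<and> (\<exists>x<n. \<exists>y<n. f x y z = a)}" using z a h12n by auto
        qed
        show ?thesis unfolding dims3_def dims2_def X Y Z c_def by (simp add: add_mset_commute)
      qed
      have "inj_on (dims2 n (\<lambda>x y. f x y h1)) L1" if inj: "inj_on (dims3 n f) (labels3 n f)"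
      proof (rule inj_onI)
        fix a b assume ab: "a \<in> L1" "b \<in> L1"
          and eq: "dims2 n (\<lambda>x y. f x y h1) a = dims2 n (\<lambda>x y. f x y h1) b"
        then have "dims3 n f a = dims3 n f b" by (simp add: dims)
        then show "a = b" using inj_onD[OF inj] ab \<open>S \<union> L1 = labels3 n f\<close> by blast
      qed
      then show ?thesis
        using box_classes_layer[OF f h12n(1)] card bound unfolding L1_def by blast
    next
      case False
      show ?thesis
      proof (cases "h1 = h2")
        case True
        then have N: "N = {h1}" using between h12 by force
        have S1: "1 \<noteq> card S" using False True by (auto simp: d_def)
        have "card S \<noteq> 0"
        proof
          assume "card S = 0"
          then have "S = {}" using finS by simp
          then have "{..<n} \<subseteq> {h1}" using trivial N n by (metis empty_iff lessThan_iff less_le_trans pos2 singletonI subsetI)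
          then have "n \<le> 1" using card_mono[of "{h1}" "{..<n}"] by simp
          then show False using n by simp
        qed
        then have "2 \<le> card S" using S1 by linarith
        then obtain q where q: "card S = q + 2" by (metis le_add_diff_inverse2)
        have "L2 = L1" by (simp add: L1_def L2_def True)
        have "R = {}"
        proof (rule ccontr)
          assume "R \<noteq> {}"
          then obtain x y z where xyz: "x < n" "y < n" "z < n" "f x y z \<in> R"
            unfolding R_def labels3_def by blast
          then have "z \<in> N" using trivial unfolding R_def by blast
          then have "f x y z \<in> L1" using N xyz unfolding L1_def labels2_def by blast
          then show False using xyz by (simp add: R_def)
        qed
        have "(\<Sum>i<n. \<Sum>j<n. card S) \<le> ?I"
        proof (intro sum_mono)
          fix i j assume "i \<in> {..<n}" "j \<in> {..<n}"
          then show "card S \<le> changes n (\<lambda>c. f i j c)" using column[of i j] by simp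
        qed
        then have "n\<^sup>2 * (q + 2) \<le> ?I" by (simp only: const_sum q)
        moreover have "q \<le> n\<^sup>2 * q" using nn(1) by simp
        moreover have "n\<^sup>2 * (q + 2) = n\<^sup>2 * q + 2 * n\<^sup>2" by (simp add: algebra_simps)
        ultimately have "n\<^sup>2 + n + q \<le> ?I" using nn by linarith
        moreover have "?w h1 \<le> (\<Sum>h<n. ?w h)" by (rule member_le_sum) (use h12n in auto)
        moreover have "card (labels3 n f) \<le> q + 2 + m h1"
          using total mL q \<open>R = {}\<close> \<open>L2 = L1\<close> by simp
        ultimately show ?thesis
          using walls[OF h12(1)] unfolding iface_layers[of n f] by linarith
      next
        case neq: False
        have "n\<^sup>2 + card S + card R \<le> ?I"
        proof -
          consider "card S = 0" | "card S = 1" | q where "card S = q + 2"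
            by (metis add_2_eq_Suc' not0_implies_Suc One_nat_def)
          then show ?thesis
          proof cases
            case 1
            have "(\<Sum>i<n. \<Sum>j<n. 1 + r i j) \<le> ?I"
            proof (intro sum_mono)
              fix i j assume "i \<in> {..<n}" "j \<in> {..<n}"
              then show "1 + r i j \<le> changes n (\<lambda>c. f i j c)"
                using column[of i j] rd[of i j] cover[of i j] by (cases "r i j = 0") auto
            qed
            then show ?thesis using cardR 1 by (simp only: sum.distrib const_sum)
          next
            case 2
            then obtain i0 j0 where ij0: "i0 < n" "j0 < n" "d i0 j0 \<noteq> 0" using False by blast
            have "(\<Sum>i<n. \<Sum>j<n. 1 + (d i j + r i j)) \<le> ?I"
            proof (intro sum_mono)
              fix i j assume "i \<in> {..<n}" "j \<in> {..<n}"
              then show "1 + (d i j + r i j) \<le> changes n (\<lambda>c. f i j c)"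
                using column[of i j] 2 by simp
            qed
            moreover have "1 \<le> (\<Sum>i<n. \<Sum>j<n. d i j)"
            proof -
              have "d i0 j0 \<le> (\<Sum>j<n. d i0 j)" by (rule member_le_sum) (use ij0 in auto)
              also have "\<dots> \<le> (\<Sum>i<n. \<Sum>j<n. d i j)"
                by (rule member_le_sum[of i0 _ "\<lambda>i. \<Sum>j<n. d i j"]) (use ij0 in auto)
              finally show ?thesis using ij0 by simp
            qed
            ultimately show ?thesis using cardR 2 by (simp only: sum.distrib const_sum)
          next
            case (3 q)
            have "(\<Sum>i<n. \<Sum>j<n. (q + 2) + r i j) \<le> ?I"
            proof (intro sum_mono)
              fix i j assume "i \<in> {..<n}" "j \<in> {..<n}"
              then show "(q + 2) + r i j \<le> changes n (\<lambda>c. f i j c)"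
                using column[of i j] 3 by simp
            qed
            then have "n\<^sup>2 * (q + 2) + (\<Sum>i<n. \<Sum>j<n. r i j) \<le> ?I"
              by (simp only: sum.distrib const_sum distrib_left)
            moreover have "q \<le> n\<^sup>2 * q" using nn(1) by simp
            moreover have "n\<^sup>2 * (q + 2) = n\<^sup>2 * q + 2 * n\<^sup>2" by (simp add: algebra_simps)
            ultimately show ?thesis using cardR 3 nn by linarith
          qed
        qed
        moreover have "(\<Sum>h\<in>{h1, h2}. ?w h) \<le> (\<Sum>h<n. ?w h)"
          by (rule sum_mono2) (use h12n in auto)
        moreover have "(\<Sum>h\<in>{h1, h2}. ?w h) = ?w h1 + ?w h2" using neq by simp
        moreover have "card (L1 \<union> L2) \<le> m h1 + m h2" using card_Un_le[of L1 L2] mL by simp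
        ultimately show ?thesis
          using walls[OF h12(1)] walls[OF h12(2)] total unfolding iface_layers[of n f] by linarith
      qed
    qed
  qed
qed

text \<open>
  Cyclic rotation of the axes reduces the case of an axis along which no piece spans the cube to
  the third axis.
\<close>

lemma iface_lower_bound:
  fixes f :: "nat \<Rightarrow> nat \<Rightarrow> nat \<Rightarrow> 'a"
  assumes f: "box_classes n f" and n: "2 \<le> n" and four: "4 \<le> card (labels3 n f)"
  shows "n\<^sup>2 + 2 * n + card (labels3 n f) \<le> iface n f + 4 \<or>
    (\<exists>g :: nat \<Rightarrow> nat \<Rightarrow> 'a. rect_classes n g \<and> card (labels2 n g) + 1 = card (labels3 n f) \<and>
      n\<^sup>2 + walls n g \<le> iface n f \<and>
      (inj_on (dims3 n f) (labels3 n f) \<longrightarrow> inj_on (dims2 n g) (labels2 n g)))"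
proof -
  define f1 where "f1 = (\<lambda>x y z. f y z x)"
  define f2 where "f2 = (\<lambda>x y z. f1 y z x)"
  have f1: "box_classes n f1" unfolding f1_def by (rule box_classes_rotate[OF f])
  have f2: "box_classes n f2" unfolding f2_def by (rule box_classes_rotate[OF f1])
  have e1: "labels3 n f1 = labels3 n f" "iface n f1 = iface n f" "dims3 n f1 = dims3 n f"
    unfolding f1_def by (rule labels3_rotate iface_rotate dims3_rotate)+
  have "labels3 n f2 = labels3 n f1" "iface n f2 = iface n f1" "dims3 n f2 = dims3 n f1"
    unfolding f2_def by (rule labels3_rotate iface_rotate dims3_rotate)+
  with e1 have e2: "labels3 n f2 = labels3 n f" "iface n f2 = iface n f" "dims3 n f2 = dims3 n f"
    by simp_all
  consider
    (z) "\<forall>i<n. \<forall>j<n. changes n (\<lambda>c. f i j c) \<noteq> 0"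
    | (y) "\<forall>i<n. \<forall>j<n. changes n (\<lambda>c. f1 i j c) \<noteq> 0"
    | (x) "\<forall>i<n. \<forall>j<n. changes n (\<lambda>c. f2 i j c) \<noteq> 0"
    | (none) x2 y2 x1 z1 y0 z0 where
      "x2 < n" "y2 < n" "changes n (\<lambda>c. f x2 y2 c) = 0"
      "x1 < n" "z1 < n" "changes n (\<lambda>c. f x1 c z1) = 0"
      "y0 < n" "z0 < n" "changes n (\<lambda>c. f c y0 z0) = 0"
    unfolding f2_def f1_def by blast
  then show ?thesis
  proof cases
    case z
    then show ?thesis using iface_ge_axis_unspanned[OF f n four] by blast
  next
    case y
    then show ?thesis using iface_ge_axis_unspanned[OF f1 n] four unfolding e1 by blast
  next
    case x
    then show ?thesis using iface_ge_axis_unspanned[OF f2 n] four unfolding e2 by blast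
  next
    case none
    then show ?thesis using iface_ge_all_axes_spanned[OF f] four by force
  qed
qed

section \<open>Divisions into boxes as exact covers of unit cells\<close>

text \<open>
  A unit cell is named by its lower corner: \<open>in_ivl I x\<close> says that the unit interval from \<open>x\<close> to
  \<open>x + 1\<close> lies in \<open>I\<close>. Since end points are integers, this holds iff the midpoint of the unit
  interval lies in \<open>I\<close>, or equivalently in its interior.
\<close>

definition in_ivl :: "ivl \<Rightarrow> nat \<Rightarrow> bool" where
  "in_ivl I x \<longleftrightarrow> fst I \<le> x \<and> x < snd I"

lemma mid_in_seg: "real x + 1/2 \<in> seg I \<longleftrightarrow> in_ivl I x"
  unfolding seg_def in_ivl_def by (auto; linarith)

lemma mid_in_interior_seg: "real x + 1/2 \<in> interior (seg I) \<longleftrightarrow> in_ivl I x"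
  unfolding seg_def in_ivl_def by (auto; linarith)

lemma interior_seg_overlap:
  assumes "r \<in> interior (seg I)" "r \<in> interior (seg J)"
  shows "\<exists>x. in_ivl I x \<and> in_ivl J x"
  using assms unfolding seg_def in_ivl_def by (intro exI[of _ "max (fst I) (fst J)"]) auto

lemma in_unit_seg:
  assumes "0 < n" "0 \<le> r" "r \<le> real n"
  shows "\<exists>x<n. r \<in> seg (x, x + 1)"
proof (cases "r = real n")
  case True
  then show ?thesis using \<open>0 < n\<close> by (intro exI[of _ "n - 1"]) (auto simp: seg_def)
next
  case False
  then have "nat \<lfloor>r\<rfloor> < n" using assms by linarith
  moreover have "r \<in> seg (nat \<lfloor>r\<rfloor>, nat \<lfloor>r\<rfloor> + 1)" using assms unfolding seg_def by (simp; linarith)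
  ultimately show ?thesis by blast
qed

lemma unit_seg_le: "x < n \<Longrightarrow> seg (x, x + 1) \<subseteq> {0..real n}"
  by (auto simp: seg_def)

lemma unit_seg_subset: "in_ivl I x \<Longrightarrow> seg (x, x + 1) \<subseteq> seg I"
  unfolding seg_def in_ivl_def by auto

lemma mid_in_unit_seg: "real x + 1/2 \<in> seg (x, x + 1)"
  by (auto simp: seg_def)

lemma seg_subset: "proper I \<Longrightarrow> seg I \<subseteq> {0..real n} \<longleftrightarrow> snd I \<le> n"
  by (auto simp: seg_def proper_def)

lemma seg_nonempty: "proper I \<Longrightarrow> seg I \<noteq> {}"
  by (auto simp: seg_def proper_def)

lemma seg_inject: "proper I \<Longrightarrow> proper J \<Longrightarrow> seg I = seg J \<Longrightarrow> I = J"
  by (auto simp: seg_def proper_def prod_eq_iff Icc_eq_Icc)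

lemma point_seg_side:
  assumes "proper I" "0 < c" "real c \<in> seg I"
  shows "in_ivl I (c - 1) \<or> in_ivl I c"
  using assms by (auto simp: seg_def proper_def in_ivl_def)

lemma point_seg_subset: "0 < c \<Longrightarrow> seg (c, c) \<subseteq> seg (c - 1, c - 1 + 1)" "seg (c, c) \<subseteq> seg (c, c + 1)"
  by (auto simp: seg_def)

lemma card_in_ivl: "snd I \<le> n \<Longrightarrow> card {x. x < n \<and> in_ivl I x} = len I"
proof -
  assume "snd I \<le> n"
  then have "{x. x < n \<and> in_ivl I x} = {fst I..<snd I}" by (auto simp: in_ivl_def)
  then show ?thesis by (simp add: len_def)
qed

lemma in_ivl_convex: "in_ivl I x \<Longrightarrow> in_ivl I x' \<Longrightarrow> min x x' \<le> u \<Longrightarrow> u \<le> max x x' \<Longrightarrow> in_ivl I u"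
  by (auto simp: in_ivl_def)

lemma in_ivl_proper: "proper I \<Longrightarrow> in_ivl I (fst I)"
  by (simp add: in_ivl_def proper_def)

text \<open>
  A family of boxes that are unions of unit cells divides a region iff its members lie in the region
  and every cell of the region lies in exactly one of them. Here \<open>cell c\<close> is the closed cell named \<open>c\<close>, \<open>mid c\<close> its midpoint, and
  \<open>has p c\<close> says that the piece \<open>p\<close> contains the cell; the same argument serves squares and cubes.
\<close>

lemma division_of_cells:
  fixes reg :: "'p \<Rightarrow> 'v::euclidean_space set" and cell :: "'c \<Rightarrow> 'v set"
  assumes finD: "finite D"
    and box: "\<And>p. p \<in> D \<Longrightarrow> reg p \<noteq> {} \<and> (\<exists>a b. reg p = cbox a b)"
    and inj: "\<And>p q. p \<in> D \<Longrightarrow> q \<in> D \<Longrightarrow> reg p = reg q \<Longrightarrow> p = q"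
    and U: "U = (\<Union>c\<in>C. cell c)"
    and mid: "\<And>c. c \<in> C \<Longrightarrow> mid c \<in> cell c"
    and mid_has: "\<And>p c. p \<in> D \<Longrightarrow> mid c \<in> reg p \<longleftrightarrow> has p c"
    and mid_int: "\<And>p c. p \<in> D \<Longrightarrow> mid c \<in> interior (reg p) \<longleftrightarrow> has p c"
    and cell: "\<And>p c. p \<in> D \<Longrightarrow> has p c \<Longrightarrow> cell c \<subseteq> reg p"
    and overlap: "\<And>p q. p \<in> D \<Longrightarrow> q \<in> D \<Longrightarrow> interior (reg p) \<inter> interior (reg q) \<noteq> {} \<Longrightarrow>
      \<exists>c. has p c \<and> has q c"
    and hasC: "\<And>p c. p \<in> D \<Longrightarrow> reg p \<subseteq> U \<Longrightarrow> has p c \<Longrightarrow> c \<in> C"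
  shows "(reg ` D) division_of U \<longleftrightarrow> (\<forall>p\<in>D. reg p \<subseteq> U) \<and> (\<forall>c\<in>C. \<exists>!p. p \<in> D \<and> has p c)"
proof
  assume div: "(reg ` D) division_of U"
  have sub: "\<forall>p\<in>D. reg p \<subseteq> U" using division_ofD(2)[OF div] by blast
  moreover have "\<exists>!p. p \<in> D \<and> has p c" if "c \<in> C" for c
  proof -
    have "mid c \<in> \<Union>(reg ` D)" using division_ofD(6)[OF div] U mid that by blast
    then obtain p where p: "p \<in> D" "has p c" using mid_has by blast
    moreover have "q = p" if q: "q \<in> D" "has q c" for q
    proof (rule inj[OF q(1) p(1)], rule ccontr)
      assume "reg q \<noteq> reg p"
      then have "interior (reg q) \<inter> interior (reg p) = {}"
        using division_ofD(5)[OF div, of "reg q" "reg p"] p q by blast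
      then show False using mid_int p q by blast
    qed
    ultimately show ?thesis by blast
  qed
  ultimately show "(\<forall>p\<in>D. reg p \<subseteq> U) \<and> (\<forall>c\<in>C. \<exists>!p. p \<in> D \<and> has p c)" by blast
next
  assume *: "(\<forall>p\<in>D. reg p \<subseteq> U) \<and> (\<forall>c\<in>C. \<exists>!p. p \<in> D \<and> has p c)"
  show "(reg ` D) division_of U"
  proof (rule division_ofI)
    show "finite (reg ` D)" using finD by simp
    show "\<And>K. K \<in> reg ` D \<Longrightarrow> K \<subseteq> U" using * by blast
    show "\<And>K. K \<in> reg ` D \<Longrightarrow> K \<noteq> {}" "\<And>K. K \<in> reg ` D \<Longrightarrow> \<exists>a b. K = cbox a b"
      using box by blast+
    show "\<Union>(reg ` D) = U"
    proof
      show "\<Union>(reg ` D) \<subseteq> U" using * by blast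
      show "U \<subseteq> \<Union>(reg ` D)" unfolding U using * cell by blast
    qed
    fix K K' assume "K \<in> reg ` D" "K' \<in> reg ` D" "K \<noteq> K'"
    then obtain p q where pq: "p \<in> D" "q \<in> D" "K = reg p" "K' = reg q" "p \<noteq> q" by blast
    show "interior K \<inter> interior K' = {}"
    proof (rule ccontr)
      assume "interior K \<inter> interior K' \<noteq> {}"
      then obtain c where "has p c" "has q c" using overlap pq by blast
      then show False using * hasC pq by blast
    qed
  qed
qed

text \<open>
  The face \<open>X\<close> common to the adjacent cells \<open>c\<close> and \<open>c'\<close> separates two pieces iff these cells belong to
  different pieces: a piece containing the face contains one of the two cells.
\<close>

lemma separates_cells:
  assumes inj: "\<And>p q. p \<in> D \<Longrightarrow> q \<in> D \<Longrightarrow> reg p = reg q \<Longrightarrow> p = q"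
    and g: "\<And>c p. c \<in> C \<Longrightarrow> (p \<in> D \<and> has p c) = (p = g c)"
    and cell: "\<And>p c. p \<in> D \<Longrightarrow> has p c \<Longrightarrow> cell c \<subseteq> reg p"
    and c: "c \<in> C" "c' \<in> C"
    and face: "X \<subseteq> cell c" "X \<subseteq> cell c'"
    and sides: "\<And>p. p \<in> D \<Longrightarrow> X \<subseteq> reg p \<Longrightarrow> has p c \<or> has p c'"
  shows "separates X (reg ` D) \<longleftrightarrow> g c \<noteq> g c'"
proof
  assume "separates X (reg ` D)"
  then obtain p q where pq: "p \<in> D" "q \<in> D" "p \<noteq> q" "X \<subseteq> reg p" "X \<subseteq> reg q"
    unfolding separates_def by blast
  then show "g c \<noteq> g c'" using sides g c by metis
next
  assume ne: "g c \<noteq> g c'"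
  have D: "g c \<in> D" "g c' \<in> D" "has (g c) c" "has (g c') c'" using g c by blast+
  then have "reg (g c) \<noteq> reg (g c')" using inj ne by blast
  moreover have "X \<subseteq> reg (g c) \<inter> reg (g c')" using cell D face by blast
  ultimately show "separates X (reg ` D)" unfolding separates_def using D by blast
qed

section \<open>Square tilings as labellings\<close>

lemma card_pairs:
  "card {(c, i). 0 < c \<and> c < n \<and> i < n \<and> P c i} = (\<Sum>i<n. card {c::nat. 0 < c \<and> c < n \<and> P c (i::nat)})"
proof -
  have "{(c, i). 0 < c \<and> c < n \<and> i < n \<and> P c i} =
      prod.swap ` (SIGMA i:{..<n}. {c. 0 < c \<and> c < n \<and> P c i})"
    by auto
  then have "card {(c, i). 0 < c \<and> c < n \<and> i < n \<and> P c i} =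
      card (SIGMA i:{..<n}. {c. 0 < c \<and> c < n \<and> P c i})"
    by (simp add: card_image)
  then show ?thesis by simp
qed

lemma card_triples:
  "card {(c, i, j). 0 < c \<and> c < n \<and> i < n \<and> j < n \<and> P c i j} =
    (\<Sum>i<n. \<Sum>j<n. card {c::nat. 0 < c \<and> c < n \<and> P c (i::nat) (j::nat)})"
proof -
  let ?S = "SIGMA i:{..<n}. SIGMA j:{..<n}. {c. 0 < c \<and> c < n \<and> P c i j}"
  have "(c, i, j) \<in> (\<lambda>(i, j, c). (c, i, j)) ` ?S" if "0 < c" "c < n" "i < n" "j < n" "P c i j" for c i j
    using that by (intro image_eqI[of _ _ "(i, j, c)"]) auto
  then have "{(c, i, j). 0 < c \<and> c < n \<and> i < n \<and> j < n \<and> P c i j} = (\<lambda>(i, j, c). (c, i, j)) ` ?S"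
    by auto
  moreover have "inj_on (\<lambda>(i, j, c). (c, i, j)) ?S" by (auto simp: inj_on_def)
  ultimately have "card {(c, i, j). 0 < c \<and> c < n \<and> i < n \<and> j < n \<and> P c i j} = card ?S"
    by (simp add: card_image)
  then show ?thesis by simp
qed

text \<open>
  \<open>rect_has p c\<close> says that the rectangle \<open>p\<close> contains the unit cell with lower corner \<open>c\<close>.
\<close>

fun rect_has :: "rect \<Rightarrow> nat \<times> nat \<Rightarrow> bool" where
  "rect_has (I, J) (x, y) \<longleftrightarrow> in_ivl I x \<and> in_ivl J y"

text \<open>
  The rectangles are nondegenerate and lie in the square of side \<open>n\<close>.
\<close>

definition proper_rects :: "nat \<Rightarrow> rect set \<Rightarrow> bool" where
  "proper_rects n D \<longleftrightarrow> (\<forall>(I, J)\<in>D. proper I \<and> proper J \<and> snd I \<le> n \<and> snd J \<le> n)"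

lemma rect_region_inj:
  assumes D: "\<forall>(I, J)\<in>D. proper I \<and> proper J" and pq: "p \<in> D" "q \<in> D"
    and eq: "rect_region p = rect_region q"
  shows "p = q"
proof -
  obtain I J I' J' where IJ: "p = (I, J)" "q = (I', J')" by (cases p; cases q)
  then have "proper I" "proper J" "proper I'" "proper J'" using D pq by auto
  moreover from this have "seg I = seg I'" "seg J = seg J'"
    using eq seg_nonempty unfolding IJ by (auto simp: times_eq_iff)
  ultimately show ?thesis unfolding IJ using seg_inject by blast
qed

lemma rect_cell_subset:
  "rect_has p c \<Longrightarrow> rect_region ((fst c, fst c + 1), (snd c, snd c + 1)) \<subseteq> rect_region p"
  by (cases p; cases c) (use unit_seg_subset in fastforce)

lemma square_tiling_iff:
  assumes n: "0 < n"
  shows "square_tiling n m D \<longleftrightarrow> finite D \<and> card D = m \<and> inj_on rect_dims D \<and> proper_rects n D \<and>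
    (\<forall>c\<in>{..<n} \<times> {..<n}. \<exists>!p. p \<in> D \<and> rect_has p c)"
proof -
  let ?U = "{0..real n} \<times> {0..real n}" and ?C = "{..<n} \<times> {..<n}"
  let ?cell = "\<lambda>c. rect_region ((fst c, fst c + 1), (snd c, snd c + 1))"
  have div: "(rect_region ` D) division_of ?U \<longleftrightarrow>
      (\<forall>p\<in>D. rect_region p \<subseteq> ?U) \<and> (\<forall>c\<in>?C. \<exists>!p. p \<in> D \<and> rect_has p c)"
    if fin: "finite D" and D: "\<forall>(I, J)\<in>D. proper I \<and> proper J"
  proof (rule division_of_cells[where cell = ?cell and mid = "\<lambda>(x, y). (real x + 1/2, real y + 1/2)"])
    show "finite D" by (rule fin)
    fix p assume p: "p \<in> D"
    obtain I J where IJ: "p = (I, J)" by (cases p)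
    have pr: "proper I" "proper J" using D p IJ by auto
    have "rect_region p = cbox (real (fst I), real (fst J)) (real (snd I), real (snd J))"
      by (simp add: IJ seg_def cbox_Pair_eq)
    then show "rect_region p \<noteq> {} \<and> (\<exists>a b. rect_region p = cbox a b)"
      using seg_nonempty[OF pr(1)] seg_nonempty[OF pr(2)] unfolding IJ by (auto simp: times_eq_iff)
    show "\<And>q. q \<in> D \<Longrightarrow> rect_region p = rect_region q \<Longrightarrow> p = q" by (rule rect_region_inj[OF D p])
    show "(case c of (x, y) \<Rightarrow> (real x + 1/2, real y + 1/2)) \<in> rect_region p \<longleftrightarrow> rect_has p c" for c
      unfolding IJ by (cases c) (simp add: mid_in_seg del: of_nat_add)
    show "(case c of (x, y) \<Rightarrow> (real x + 1/2, real y + 1/2)) \<in> interior (rect_region p) \<longleftrightarrow> rect_has p c" for c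
      unfolding IJ by (cases c) (simp add: interior_Times mid_in_interior_seg)
    show "?cell c \<subseteq> rect_region p" if "rect_has p c" for c
      using rect_cell_subset[OF that] .
    show "\<exists>c. rect_has p c \<and> rect_has q c"
      if q: "q \<in> D" and ne: "interior (rect_region p) \<inter> interior (rect_region q) \<noteq> {}" for q
    proof -
      obtain I' J' where q': "q = (I', J')" by (cases q)
      from ne obtain a b where "a \<in> interior (seg I)" "a \<in> interior (seg I')"
        "b \<in> interior (seg J)" "b \<in> interior (seg J')"
        unfolding IJ q' by (auto simp: interior_Times)
      then obtain x y where "in_ivl I x" "in_ivl I' x" "in_ivl J y" "in_ivl J' y"
        using interior_seg_overlap by metis
      then show ?thesis unfolding IJ q' by (intro exI[of _ "(x, y)"]) simp
    qed
    show "c \<in> ?C" if "rect_region p \<subseteq> ?U" "rect_has p c" for c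
    proof -
      have "snd I \<le> n" "snd J \<le> n"
        using that(1) pr seg_nonempty[of I] seg_nonempty[of J] seg_subset unfolding IJ
        by (auto simp: times_subset_iff)
      then show ?thesis using that(2) unfolding IJ by (cases c) (auto simp: in_ivl_def)
    qed
  next
    show "?U = (\<Union>c\<in>?C. ?cell c)"
    proof
      show "?U \<subseteq> (\<Union>c\<in>?C. ?cell c)"
      proof
        fix p assume "p \<in> ?U"
        then obtain a b where p: "p = (a, b)" "0 \<le> a" "a \<le> n" "0 \<le> b" "b \<le> n" by auto
        then obtain x y where "x < n" "y < n" "a \<in> seg (x, x + 1)" "b \<in> seg (y, y + 1)"
          using in_unit_seg[OF n] by metis
        then show "p \<in> (\<Union>c\<in>?C. ?cell c)" unfolding p by (intro UN_I[of "(x, y)"]) auto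
      qed
      show "(\<Union>c\<in>?C. ?cell c) \<subseteq> ?U"
      proof (rule UN_least)
        fix c assume "c \<in> ?C"
        then show "?cell c \<subseteq> ?U"
          unfolding rect_region.simps by (intro Sigma_mono unit_seg_le) auto
      qed
    qed
    show "(case c of (x, y) \<Rightarrow> (real x + 1/2, real y + 1/2)) \<in> ?cell c" for c
      using mid_in_unit_seg by (cases c) simp
  qed
  have inside: "(\<forall>p\<in>D. rect_region p \<subseteq> ?U) \<longleftrightarrow> proper_rects n D"
    if D: "\<forall>(I, J)\<in>D. proper I \<and> proper J"
  proof -
    have "rect_region (I, J) \<subseteq> ?U \<longleftrightarrow> snd I \<le> n \<and> snd J \<le> n" if "(I, J) \<in> D" for I J
      using D that seg_nonempty[of I] seg_nonempty[of J] seg_subset[of I n] seg_subset[of J n]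
      by (auto simp: times_subset_iff)
    then show ?thesis using D unfolding proper_rects_def by fast
  qed
  have proper: "\<forall>(I, J)\<in>D. proper I \<and> proper J" if "proper_rects n D"
    using that unfolding proper_rects_def by auto
  show ?thesis
  proof (cases "finite D \<and> (\<forall>(I, J)\<in>D. proper I \<and> proper J)")
    case True
    then have "(rect_region ` D) division_of ?U \<longleftrightarrow>
        proper_rects n D \<and> (\<forall>c\<in>?C. \<exists>!p. p \<in> D \<and> rect_has p c)"
      using div inside by simp
    then show ?thesis unfolding square_tiling_def using True by argo
  next
    case False
    then show ?thesis unfolding square_tiling_def using proper by argo
  qed
qed

text \<open>
  \<open>g\<close> maps each unit cell of the square to the unique member of \<open>D\<close> that contains it.
\<close>

definition rect_labelling :: "nat \<Rightarrow> rect set \<Rightarrow> (nat \<Rightarrow> nat \<Rightarrow> rect) \<Rightarrow> bool" where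
  "rect_labelling n D g \<longleftrightarrow> (\<forall>x<n. \<forall>y<n. \<forall>p. p \<in> D \<and> rect_has p (x, y) \<longleftrightarrow> p = g x y)"

lemma rect_labellingD:
  "rect_labelling n D g \<Longrightarrow> x < n \<Longrightarrow> y < n \<Longrightarrow> (p \<in> D \<and> rect_has p (x, y)) = (p = g x y)"
  unfolding rect_labelling_def by blast

lemma wall_length_eq:
  assumes D: "proper_rects n D"
    and lab: "rect_labelling n D g"
  shows "wall_length n D = walls n g"
proof -
  note g = rect_labellingD[OF lab]
  let ?C = "{..<n} \<times> {..<n}"
  let ?cell = "\<lambda>c. rect_region ((fst c, fst c + 1), (snd c, snd c + 1))"
  have pr: "\<forall>(I, J)\<in>D. proper I \<and> proper J" using D by (auto simp: proper_rects_def)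
  have g': "(p \<in> D \<and> rect_has p c) = (p = (case c of (x, y) \<Rightarrow> g x y))" if "c \<in> ?C" for c p
  proof -
    obtain x y where c: "c = (x, y)" "x < n" "y < n" using \<open>c \<in> ?C\<close> by blast
    show ?thesis unfolding c(1) prod.case by (rule g[OF c(2,3)])
  qed
  note sep = separates_cells[where reg = rect_region and D = D and C = ?C and cell = ?cell
      and has = rect_has and g = "\<lambda>(x, y). g x y", OF rect_region_inj[OF pr] g' rect_cell_subset]
  have 1: "separates (seg (c, c) \<times> seg (i, i + 1)) (rect_region ` D) \<longleftrightarrow> g (c - 1) i \<noteq> g c i"
    if c: "0 < c" "c < n" "i < n" for c i
  proof -
    have "separates (seg (c, c) \<times> seg (i, i + 1)) (rect_region ` D) \<longleftrightarrow>
        (case (c - 1, i) of (x, y) \<Rightarrow> g x y) \<noteq> (case (c, i) of (x, y) \<Rightarrow> g x y)"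
    proof (rule sep)
      show "rect_has p (c - 1, i) \<or> rect_has p (c, i)"
        if "p \<in> D" "seg (c, c) \<times> seg (i, i + 1) \<subseteq> rect_region p" for p
      proof -
        obtain I J where p: "p = (I, J)" by (cases p)
        have "(real c, real i + 1/2) \<in> seg (c, c) \<times> seg (i, i + 1)" by (auto simp: seg_def)
        then have "real c \<in> seg I" "real i + 1/2 \<in> seg J" using that(2) unfolding p by auto
        then show ?thesis using point_seg_side[of I c] pr that(1) c(1) unfolding p by (auto simp: mid_in_seg)
      qed
    qed (use c point_seg_subset[of c] in auto)
    then show ?thesis by simp
  qed
  have 2: "separates (seg (i, i + 1) \<times> seg (c, c)) (rect_region ` D) \<longleftrightarrow> g i (c - 1) \<noteq> g i c"
    if c: "0 < c" "c < n" "i < n" for c i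
  proof -
    have "separates (seg (i, i + 1) \<times> seg (c, c)) (rect_region ` D) \<longleftrightarrow>
        (case (i, c - 1) of (x, y) \<Rightarrow> g x y) \<noteq> (case (i, c) of (x, y) \<Rightarrow> g x y)"
    proof (rule sep)
      show "rect_has p (i, c - 1) \<or> rect_has p (i, c)"
        if "p \<in> D" "seg (i, i + 1) \<times> seg (c, c) \<subseteq> rect_region p" for p
      proof -
        obtain I J where p: "p = (I, J)" by (cases p)
        have "(real i + 1/2, real c) \<in> seg (i, i + 1) \<times> seg (c, c)" by (auto simp: seg_def)
        then have "real c \<in> seg J" "real i + 1/2 \<in> seg I" using that(2) unfolding p by auto
        then show ?thesis using point_seg_side[of J c] pr that(1) c(1) unfolding p by (auto simp: mid_in_seg)
      qed
    qed (use c point_seg_subset[of c] in auto)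
    then show ?thesis by simp
  qed
  show ?thesis
    unfolding wall_length_def walls_def changes_def card_pairs
    by (intro arg_cong2[where f = "(+)"] sum.cong refl arg_cong[where f = card]) (use 1 2 in auto)
qed

lemma convex_set_ivl:
  assumes "X \<subseteq> {..<n}" "X \<noteq> {}"
    and conv: "\<forall>x\<in>X. \<forall>x'\<in>X. \<forall>u. x \<le> u \<and> u \<le> x' \<longrightarrow> u \<in> X"
  shows "\<exists>I. proper I \<and> snd I \<le> n \<and> (\<forall>x. in_ivl I x \<longleftrightarrow> x \<in> X)"
proof -
  have fin: "finite X" using assms(1) finite_subset by blast
  have mm: "Min X \<in> X" "Max X \<in> X" using fin assms(2) by auto
  have "proper (Min X, Max X + 1)" using fin mm by (simp add: proper_def less_Suc_eq_le)
  moreover have "snd (Min X, Max X + 1) \<le> n" using mm assms(1) by auto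
  moreover have "in_ivl (Min X, Max X + 1) x \<longleftrightarrow> x \<in> X" for x
  proof
    assume "in_ivl (Min X, Max X + 1) x"
    then have "Min X \<le> x" "x \<le> Max X" by (auto simp: in_ivl_def)
    then show "x \<in> X" using conv mm by blast
  next
    assume "x \<in> X"
    then show "in_ivl (Min X, Max X + 1) x" using fin by (simp add: in_ivl_def less_Suc_eq_le)
  qed
  ultimately show ?thesis by blast
qed

text \<open>
  Conversely, a labelling by rectangles comes from a tiling. The injectivity premise also makes
  the map \<open>R\<close> from labels to rectangles injective, so that walls are preserved.
\<close>

lemma tiling_of_classes:
  assumes n: "0 < n" and g: "rect_classes n g" and inj: "inj_on (dims2 n g) (labels2 n g)"
  shows "\<exists>D. square_tiling n (card (labels2 n g)) D \<and> wall_length n D = walls n g"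
proof -
  have "\<exists>p. proper_rects n {p} \<and> (\<forall>x<n. \<forall>y<n. rect_has p (x, y) \<longleftrightarrow> g x y = a) \<and> rect_dims p = dims2 n g a"
    if a: "a \<in> labels2 n g" for a
  proof -
    define X where "X = {x. x < n \<and> (\<exists>y<n. g x y = a)}"
    define Y where "Y = {y. y < n \<and> (\<exists>x<n. g x y = a)}"
    have XY: "g x y = a" if "x \<in> X" "y \<in> Y" for x y
    proof -
      from that obtain x' y' where *: "x < n" "y < n" "x' < n" "y' < n" "g x y' = a" "g x' y = a"
        unfolding X_def Y_def by blast
      have e: "g x y' = g x' y" using * by simp
      have "g x y = g x y'" by (rule rect_classesD[OF g e]) (use * in auto)
      then show ?thesis using * by simp
    qed
    have ne: "X \<noteq> {}" "Y \<noteq> {}" using a unfolding labels2_def X_def Y_def by blast+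
    have subX: "X \<subseteq> {..<n}" by (auto simp: X_def)
    have convX: "u \<in> X" if "x \<in> X" "x' \<in> X" "x \<le> u" "u \<le> x'" for x x' u
    proof -
      obtain y where y: "y \<in> Y" using ne by blast
      have e: "g x y = g x' y" using XY that y by simp
      have "g u y = g x y"
        by (rule rect_classesD[OF g e]) (use that y in \<open>auto simp: X_def Y_def\<close>)
      then have "g u y = a" using XY[OF that(1) y] by simp
      moreover have "u < n" "y < n" using that y by (auto simp: X_def Y_def)
      ultimately show ?thesis unfolding X_def by blast
    qed
    obtain I where I: "proper I" "snd I \<le> n" "\<forall>x. in_ivl I x \<longleftrightarrow> x \<in> X"
      using convex_set_ivl[OF subX ne(1)] convX by meson
    have subY: "Y \<subseteq> {..<n}" by (auto simp: Y_def)
    have convY: "u \<in> Y" if "y \<in> Y" "y' \<in> Y" "y \<le> u" "u \<le> y'" for y y' u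
    proof -
      obtain x where x: "x \<in> X" using ne by blast
      have e: "g x y = g x y'" using XY that x by simp
      have "g x u = g x y"
        by (rule rect_classesD[OF g e]) (use that x in \<open>auto simp: X_def Y_def\<close>)
      then have "g x u = a" using XY[OF x that(1)] by simp
      moreover have "u < n" "x < n" using that x by (auto simp: X_def Y_def)
      ultimately show ?thesis unfolding Y_def by blast
    qed
    obtain J where J: "proper J" "snd J \<le> n" "\<forall>x. in_ivl J x \<longleftrightarrow> x \<in> Y"
      using convex_set_ivl[OF subY ne(2)] convY by meson
    have "len I = card X" using card_in_ivl[OF I(2)] I(3) by (simp add: X_def)
    moreover have "len J = card Y" using card_in_ivl[OF J(2)] J(3) by (simp add: Y_def)
    ultimately have "rect_dims (I, J) = dims2 n g a" by (simp add: dims2_def X_def Y_def)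
    moreover have "rect_has (I, J) (x, y) \<longleftrightarrow> g x y = a" if "x < n" "y < n" for x y
      using XY I J that by (auto simp: X_def Y_def)
    ultimately show ?thesis using I J by (intro exI[of _ "(I, J)"]) (auto simp: proper_rects_def)
  qed
  then obtain R where R: "\<And>a. a \<in> labels2 n g \<Longrightarrow> proper_rects n {R a}"
    "\<And>a x y. a \<in> labels2 n g \<Longrightarrow> x < n \<Longrightarrow> y < n \<Longrightarrow> rect_has (R a) (x, y) \<longleftrightarrow> g x y = a"
    "\<And>a. a \<in> labels2 n g \<Longrightarrow> rect_dims (R a) = dims2 n g a"
    by metis
  have injR: "inj_on R (labels2 n g)" using inj R(3) unfolding inj_on_def by metis
  define D where "D = R ` labels2 n g"
  have D: "proper_rects n D" using R(1) unfolding D_def proper_rects_def by blast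
  have lab: "(p \<in> D \<and> rect_has p (x, y)) = (p = R (g x y))" if "x < n" "y < n" for x y p
  proof -
    have "g x y \<in> labels2 n g" using that unfolding labels2_def by blast
    then show ?thesis using R(2) that unfolding D_def by blast
  qed
  have "square_tiling n (card (labels2 n g)) D"
    unfolding square_tiling_iff[OF n]
  proof (intro conjI ballI)
    show "finite D" by (simp add: D_def)
    show "card D = card (labels2 n g)" unfolding D_def by (rule card_image[OF injR])
    show "inj_on rect_dims D" using inj R(3) unfolding D_def inj_on_def by auto
    show "\<exists>!p. p \<in> D \<and> rect_has p c" if "c \<in> {..<n} \<times> {..<n}" for c
      using that lab by (cases c) auto
  qed (rule D)
  moreover have "wall_length n D = walls n g"
  proof -
    have "R (g x y) = R (g x' y') \<longleftrightarrow> g x y = g x' y'" if "x < n" "y < n" "x' < n" "y' < n" for x y x' y'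
    proof (rule inj_on_eq_iff[OF injR])
      show "g x y \<in> labels2 n g" "g x' y' \<in> labels2 n g" using that unfolding labels2_def by blast+
    qed
    then have "walls n (\<lambda>x y. R (g x y)) = walls n g"
      unfolding walls_def changes_def
      by (intro arg_cong2[where f = "(+)"] sum.cong refl arg_cong[where f = card]) auto
    moreover have "rect_labelling n D (\<lambda>x y. R (g x y))" using lab unfolding rect_labelling_def by blast
    ultimately show ?thesis using wall_length_eq[OF D] by simp
  qed
  ultimately show ?thesis by blast
qed

section \<open>Cube partitions as labellings\<close>

text \<open>
  \<open>brick_has p c\<close> says that the box \<open>p\<close> contains the unit cell with lower corner \<open>c\<close>.
\<close>

fun brick_has :: "brick \<Rightarrow> nat \<times> nat \<times> nat \<Rightarrow> bool" where
  "brick_has (I, J, K) (x, y, z) \<longleftrightarrow> in_ivl I x \<and> in_ivl J y \<and> in_ivl K z"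

text \<open>
  The boxes are nondegenerate and lie in the cube of side \<open>n\<close>.
\<close>

definition proper_bricks :: "nat \<Rightarrow> brick set \<Rightarrow> bool" where
  "proper_bricks n P \<longleftrightarrow> (\<forall>(I, J, K)\<in>P. proper I \<and> proper J \<and> proper K \<and>
     snd I \<le> n \<and> snd J \<le> n \<and> snd K \<le> n)"

text \<open>
  The unit cell with the given lower corner.
\<close>

fun unit_brick :: "nat \<times> nat \<times> nat \<Rightarrow> brick" where
  "unit_brick (x, y, z) = ((x, x + 1), (y, y + 1), (z, z + 1))"

lemma brick_region_inj:
  assumes P: "\<forall>(I, J, K)\<in>P. proper I \<and> proper J \<and> proper K" and pq: "p \<in> P" "q \<in> P"
    and eq: "brick_region p = brick_region q"
  shows "p = q"
proof -
  obtain I J K I' J' K' where IJ: "p = (I, J, K)" "q = (I', J', K')" by (cases p; cases q)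
  then have "proper I" "proper J" "proper K" "proper I'" "proper J'" "proper K'" using P pq by auto
  moreover from this have "seg I = seg I'" "seg J = seg J'" "seg K = seg K'"
    using eq seg_nonempty unfolding IJ by (auto simp: times_eq_iff)
  ultimately show ?thesis unfolding IJ using seg_inject by blast
qed

lemma brick_cell_subset: "brick_has p c \<Longrightarrow> brick_region (unit_brick c) \<subseteq> brick_region p"
  by (cases p; cases c) (use unit_seg_subset in fastforce)

lemma brick_region_subset:
  assumes "proper I" "proper J" "proper K"
  shows "brick_region (I, J, K) \<subseteq> {0..real n} \<times> {0..real n} \<times> {0..real n} \<longleftrightarrow>
    snd I \<le> n \<and> snd J \<le> n \<and> snd K \<le> n"
  using assms seg_nonempty[of I] seg_nonempty[of J] seg_nonempty[of K]
    seg_subset[of I n] seg_subset[of J n] seg_subset[of K n]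
  by (auto simp: times_subset_iff)

lemma cube_partition_iff:
  assumes n: "0 < n"
  shows "cube_partition n k P \<longleftrightarrow> finite P \<and> card P = k \<and> inj_on brick_dims P \<and> proper_bricks n P \<and>
    (\<forall>c\<in>{..<n} \<times> {..<n} \<times> {..<n}. \<exists>!p. p \<in> P \<and> brick_has p c)"
proof -
  let ?U = "{0..real n} \<times> {0..real n} \<times> {0..real n}" and ?C = "{..<n} \<times> {..<n} \<times> {..<n}"
  let ?cell = "\<lambda>c. brick_region (unit_brick c)"
  let ?mid = "\<lambda>(x, y, z). (real x + 1/2, real y + 1/2, real z + 1/2)"
  have div: "(brick_region ` P) division_of ?U \<longleftrightarrow>
      (\<forall>p\<in>P. brick_region p \<subseteq> ?U) \<and> (\<forall>c\<in>?C. \<exists>!p. p \<in> P \<and> brick_has p c)"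
    if fin: "finite P" and P: "\<forall>(I, J, K)\<in>P. proper I \<and> proper J \<and> proper K"
  proof (rule division_of_cells[where cell = ?cell and mid = ?mid])
    show "finite P" by (rule fin)
    fix p assume p: "p \<in> P"
    obtain I J K where IJ: "p = (I, J, K)" by (cases p)
    have pr: "proper I" "proper J" "proper K" using P p IJ by auto
    have "brick_region p = cbox (real (fst I), real (fst J), real (fst K)) (real (snd I), real (snd J), real (snd K))"
      by (simp add: IJ seg_def cbox_Pair_eq)
    moreover have "brick_region p \<noteq> {}"
      using seg_nonempty[OF pr(1)] seg_nonempty[OF pr(2)] seg_nonempty[OF pr(3)]
      unfolding IJ by (auto simp: times_eq_iff)
    ultimately show "brick_region p \<noteq> {} \<and> (\<exists>a b. brick_region p = cbox a b)" by blast
    show "\<And>q. q \<in> P \<Longrightarrow> brick_region p = brick_region q \<Longrightarrow> p = q" by (rule brick_region_inj[OF P p])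
    show "?mid c \<in> brick_region p \<longleftrightarrow> brick_has p c" for c
      unfolding IJ by (cases c) (simp add: mid_in_seg)
    show "?mid c \<in> interior (brick_region p) \<longleftrightarrow> brick_has p c" for c
      unfolding IJ by (cases c) (simp add: interior_Times mid_in_interior_seg)
    show "?cell c \<subseteq> brick_region p" if "brick_has p c" for c
      using brick_cell_subset[OF that] .
    show "\<exists>c. brick_has p c \<and> brick_has q c"
      if q: "q \<in> P" and ne: "interior (brick_region p) \<inter> interior (brick_region q) \<noteq> {}" for q
    proof -
      obtain I' J' K' where q': "q = (I', J', K')" by (cases q)
      from ne obtain a b c where "a \<in> interior (seg I)" "a \<in> interior (seg I')"
        "b \<in> interior (seg J)" "b \<in> interior (seg J')" "c \<in> interior (seg K)" "c \<in> interior (seg K')"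
        unfolding IJ q' by (auto simp: interior_Times)
      then obtain x y z where "in_ivl I x" "in_ivl I' x" "in_ivl J y" "in_ivl J' y" "in_ivl K z" "in_ivl K' z"
        using interior_seg_overlap by metis
      then show ?thesis unfolding IJ q' by (intro exI[of _ "(x, y, z)"]) simp
    qed
    show "c \<in> ?C" if "brick_region p \<subseteq> ?U" "brick_has p c" for c
      using that brick_region_subset[OF pr] unfolding IJ by (cases c) (auto simp: in_ivl_def)
  next
    show "?U = (\<Union>c\<in>?C. ?cell c)"
    proof
      show "?U \<subseteq> (\<Union>c\<in>?C. ?cell c)"
      proof
        fix p assume "p \<in> ?U"
        then obtain a b c where p: "p = (a, b, c)" "0 \<le> a" "a \<le> n" "0 \<le> b" "b \<le> n" "0 \<le> c" "c \<le> n" by auto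
        then obtain x y z where "x < n" "y < n" "z < n"
          "a \<in> seg (x, x + 1)" "b \<in> seg (y, y + 1)" "c \<in> seg (z, z + 1)"
          using in_unit_seg[OF n] by metis
        then show "p \<in> (\<Union>c\<in>?C. ?cell c)" unfolding p by (intro UN_I[of "(x, y, z)"]) auto
      qed
      show "(\<Union>c\<in>?C. ?cell c) \<subseteq> ?U"
      proof (rule UN_least)
        fix c assume "c \<in> ?C"
        then obtain x y z where c: "c = (x, y, z)" "x < n" "y < n" "z < n" by blast
        show "?cell c \<subseteq> ?U"
          unfolding c(1) unit_brick.simps brick_region.simps by (intro Sigma_mono unit_seg_le c)
      qed
    qed
    show "?mid c \<in> ?cell c" for c
      using mid_in_unit_seg by (cases c) simp
  qed
  have inside: "(\<forall>p\<in>P. brick_region p \<subseteq> ?U) \<longleftrightarrow> proper_bricks n P"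
    if P: "\<forall>(I, J, K)\<in>P. proper I \<and> proper J \<and> proper K"
  proof -
    have "brick_region (I, J, K) \<subseteq> ?U \<longleftrightarrow> snd I \<le> n \<and> snd J \<le> n \<and> snd K \<le> n" if "(I, J, K) \<in> P" for I J K
    proof (rule brick_region_subset)
      show "proper I" "proper J" "proper K" using P that by blast+
    qed
    then show ?thesis using P unfolding proper_bricks_def by fast
  qed
  have proper: "\<forall>(I, J, K)\<in>P. proper I \<and> proper J \<and> proper K" if "proper_bricks n P"
    using that unfolding proper_bricks_def by auto
  show ?thesis
  proof (cases "finite P \<and> (\<forall>(I, J, K)\<in>P. proper I \<and> proper J \<and> proper K)")
    case True
    then have "(brick_region ` P) division_of ?U \<longleftrightarrow>
        proper_bricks n P \<and> (\<forall>c\<in>?C. \<exists>!p. p \<in> P \<and> brick_has p c)"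
      using div inside by simp
    then show ?thesis unfolding cube_partition_def using True by argo
  next
    case False
    then show ?thesis unfolding cube_partition_def using proper by argo
  qed
qed

text \<open>
  \<open>f\<close> maps each unit cell of the cube to the unique member of \<open>P\<close> that contains it.
\<close>

definition brick_labelling :: "nat \<Rightarrow> brick set \<Rightarrow> (nat \<Rightarrow> nat \<Rightarrow> nat \<Rightarrow> brick) \<Rightarrow> bool" where
  "brick_labelling n P f \<longleftrightarrow>
     (\<forall>x<n. \<forall>y<n. \<forall>z<n. \<forall>p. p \<in> P \<and> brick_has p (x, y, z) \<longleftrightarrow> p = f x y z)"

lemma brick_labellingD:
  "brick_labelling n P f \<Longrightarrow> x < n \<Longrightarrow> y < n \<Longrightarrow> z < n \<Longrightarrow>
    (p \<in> P \<and> brick_has p (x, y, z)) = (p = f x y z)"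
  unfolding brick_labelling_def by blast

lemma interface_area_eq:
  assumes P: "proper_bricks n P"
    and lab: "brick_labelling n P f"
  shows "interface_area n P = iface n f"
proof -
  note f = brick_labellingD[OF lab]
  let ?C = "{..<n} \<times> {..<n} \<times> {..<n}"
  let ?f = "\<lambda>(x, y, z). f x y z"
  have pr: "\<forall>(I, J, K)\<in>P. proper I \<and> proper J \<and> proper K" using P by (auto simp: proper_bricks_def)
  have f': "(p \<in> P \<and> brick_has p c) = (p = ?f c)" if "c \<in> ?C" for c p
  proof -
    obtain x y z where c: "c = (x, y, z)" "x < n" "y < n" "z < n" using \<open>c \<in> ?C\<close> by blast
    show ?thesis unfolding c(1) prod.case by (rule f[OF c(2-4)])
  qed
  note sep = separates_cells[where reg = brick_region and D = P and C = ?C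
      and cell = "\<lambda>c. brick_region (unit_brick c)" and has = brick_has and g = ?f,
      OF brick_region_inj[OF pr] f' brick_cell_subset]
  have 1: "separates (seg (c, c) \<times> seg (i, i + 1) \<times> seg (j, j + 1)) (brick_region ` P) \<longleftrightarrow>
      f (c - 1) i j \<noteq> f c i j"
    if c: "0 < c" "c < n" "i < n" "j < n" for c i j
  proof -
    let ?X = "seg (c, c) \<times> seg (i, i + 1) \<times> seg (j, j + 1)"
    have "separates ?X (brick_region ` P) \<longleftrightarrow> ?f (c - 1, i, j) \<noteq> ?f (c, i, j)"
    proof (rule sep)
      show "brick_has p (c - 1, i, j) \<or> brick_has p (c, i, j)" if "p \<in> P" "?X \<subseteq> brick_region p" for p
      proof -
        obtain I J K where p: "p = (I, J, K)" by (cases p)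
        have "(real c, real i + 1/2, real j + 1/2) \<in> ?X" by (auto simp: seg_def)
        then have "real c \<in> seg I" "real i + 1/2 \<in> seg J" "real j + 1/2 \<in> seg K"
          using that(2) unfolding p by auto
        then show ?thesis
          using point_seg_side[of I c] pr that(1) c(1) unfolding p by (auto simp: mid_in_seg)
      qed
    qed (use c point_seg_subset[of c] in auto)
    then show ?thesis by simp
  qed
  have 2: "separates (seg (i, i + 1) \<times> seg (c, c) \<times> seg (j, j + 1)) (brick_region ` P) \<longleftrightarrow>
      f i (c - 1) j \<noteq> f i c j"
    if c: "0 < c" "c < n" "i < n" "j < n" for c i j
  proof -
    let ?X = "seg (i, i + 1) \<times> seg (c, c) \<times> seg (j, j + 1)"
    have "separates ?X (brick_region ` P) \<longleftrightarrow> ?f (i, c - 1, j) \<noteq> ?f (i, c, j)"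
    proof (rule sep)
      show "brick_has p (i, c - 1, j) \<or> brick_has p (i, c, j)" if "p \<in> P" "?X \<subseteq> brick_region p" for p
      proof -
        obtain I J K where p: "p = (I, J, K)" by (cases p)
        have "(real i + 1/2, real c, real j + 1/2) \<in> ?X" by (auto simp: seg_def)
        then have "real i + 1/2 \<in> seg I" "real c \<in> seg J" "real j + 1/2 \<in> seg K"
          using that(2) unfolding p by auto
        then show ?thesis
          using point_seg_side[of J c] pr that(1) c(1) unfolding p by (auto simp: mid_in_seg)
      qed
    qed (use c point_seg_subset[of c] in auto)
    then show ?thesis by simp
  qed
  have 3: "separates (seg (i, i + 1) \<times> seg (j, j + 1) \<times> seg (c, c)) (brick_region ` P) \<longleftrightarrow>
      f i j (c - 1) \<noteq> f i j c"
    if c: "0 < c" "c < n" "i < n" "j < n" for c i j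
  proof -
    let ?X = "seg (i, i + 1) \<times> seg (j, j + 1) \<times> seg (c, c)"
    have "separates ?X (brick_region ` P) \<longleftrightarrow> ?f (i, j, c - 1) \<noteq> ?f (i, j, c)"
    proof (rule sep)
      show "brick_has p (i, j, c - 1) \<or> brick_has p (i, j, c)" if "p \<in> P" "?X \<subseteq> brick_region p" for p
      proof -
        obtain I J K where p: "p = (I, J, K)" by (cases p)
        have "(real i + 1/2, real j + 1/2, real c) \<in> ?X" by (auto simp: seg_def)
        then have "real i + 1/2 \<in> seg I" "real j + 1/2 \<in> seg J" "real c \<in> seg K"
          using that(2) unfolding p by auto
        then show ?thesis
          using point_seg_side[of K c] pr that(1) c(1) unfolding p by (auto simp: mid_in_seg)
      qed
    qed (use c point_seg_subset[of c] in auto)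
    then show ?thesis by simp
  qed
  show ?thesis
    unfolding interface_area_def iface_def changes_def card_triples
    by (intro arg_cong2[where f = "(+)"] sum.cong refl arg_cong[where f = card]) (use 1 2 3 in auto)
qed

lemma partition_classes:
  assumes P: "proper_bricks n P"
    and lab: "brick_labelling n P f"
  shows "box_classes n f"
  unfolding box_classes_def
proof (intro allI impI, elim conjE)
  fix x x' u y y' v z z' w
  assume *: "x < n" "x' < n" "y < n" "y' < n" "z < n" "z' < n" "f x y z = f x' y' z'"
    "min x x' \<le> u" "u \<le> max x x'" "min y y' \<le> v" "v \<le> max y y'" "min z z' \<le> w" "w \<le> max z z'"
  obtain I J K where IJ: "f x y z = (I, J, K)" by (cases "f x y z")
  have "(I, J, K) \<in> P" "brick_has (I, J, K) (x, y, z)" "brick_has (I, J, K) (x', y', z')"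
    using brick_labellingD[OF lab, of x y z "f x y z"] brick_labellingD[OF lab, of x' y' z' "f x y z"] * unfolding IJ by auto
  then have "brick_has (I, J, K) (u, v, w)"
    using in_ivl_convex[OF _ _ *(8,9)] in_ivl_convex[OF _ _ *(10,11)] in_ivl_convex[OF _ _ *(12,13)]
    by simp
  moreover have "u < n" "v < n" "w < n" using * by auto
  ultimately show "f u v w = f x y z" using brick_labellingD[OF lab, of u v w "(I, J, K)"] \<open>(I, J, K) \<in> P\<close> IJ by simp
qed

text \<open>
  Double counting of incidences between pieces and lines: \<open>Q p i j\<close> says that the piece \<open>p\<close> meets the line
  with coordinates \<open>i\<close>, \<open>j\<close>, whose labels are given by \<open>h i j\<close>, and \<open>w p\<close> is the area of the
  projection of \<open>p\<close> along the lines.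
\<close>

lemma sum_over_lines:
  assumes fin: "finite P"
    and w: "\<And>p. p \<in> P \<Longrightarrow> w p = (\<Sum>i<n. \<Sum>j<n. of_bool (Q p i j))"
    and Q: "\<And>i j. i < n \<Longrightarrow> j < n \<Longrightarrow> {p \<in> P. Q p i j} = h i j ` {..<n}"
    and h: "\<And>i j. i < n \<Longrightarrow> j < n \<Longrightarrow> convex_classes n (h i j)"
  shows "(\<Sum>p\<in>P. w p) = n\<^sup>2 + (\<Sum>i<n. \<Sum>j<n. changes n (h i j))"
proof -
  have "(\<Sum>p\<in>P. w p) = (\<Sum>p\<in>P. \<Sum>i<n. \<Sum>j<n. of_bool (Q p i j))"
    by (rule sum.cong) (auto simp: w)
  also have "\<dots> = (\<Sum>i<n. \<Sum>p\<in>P. \<Sum>j<n. of_bool (Q p i j))" by (rule sum.swap)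
  also have "\<dots> = (\<Sum>i<n. \<Sum>j<n. \<Sum>p\<in>P. of_bool (Q p i j))"
    by (rule sum.cong[OF refl]) (rule sum.swap)
  also have "\<dots> = (\<Sum>i<n. \<Sum>j<n. 1 + changes n (h i j))"
  proof (intro sum.cong refl)
    fix i j assume "i \<in> {..<n}" "j \<in> {..<n}"
    then have ij: "i < n" "j < n" by auto
    have "(\<Sum>p\<in>P. of_bool (Q p i j)) = card {p \<in> P. Q p i j}"
      using fin by (simp add: of_bool_def sum.If_cases Int_def)
    also have "\<dots> = card (h i j ` {..<n})" using Q[OF ij] by simp
    also have "\<dots> = 1 + changes n (h i j)" using card_labels_line[OF h[OF ij]] ij by simp
    finally show "(\<Sum>p\<in>P. of_bool (Q p i j)) = 1 + changes n (h i j)" .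
  qed
  also have "\<dots> = n\<^sup>2 + (\<Sum>i<n. \<Sum>j<n. changes n (h i j))"
    by (simp only: sum.distrib) (simp add: power2_eq_square)
  finally show ?thesis .
qed

lemma len_mult_len:
  assumes "snd I \<le> n" "snd J \<le> n"
  shows "len I * len J = (\<Sum>i<n. \<Sum>j<n. of_bool (in_ivl I i \<and> in_ivl J j))"
proof -
  have l: "len I = (\<Sum>i<n. of_bool (in_ivl I i))" if "snd I \<le> n" for I
  proof -
    have "(\<Sum>i<n. of_bool (in_ivl I i)) = card {x \<in> {..<n}. in_ivl I x}"
      by (simp add: of_bool_def sum.If_cases Int_def)
    then show ?thesis using card_in_ivl[OF that] by simp
  qed
  show ?thesis unfolding l[OF assms(1)] l[OF assms(2)] sum_product of_bool_conj ..
qed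

lemma surface_area_eq:
  assumes fin: "finite P" and P: "proper_bricks n P"
    and lab: "brick_labelling n P f"
  shows "(\<Sum>b\<in>P. brick_area b) = 6 * n\<^sup>2 + 2 * iface n f"
proof -
  note f = brick_labellingD[OF lab]
  note cl = partition_classes[OF P lab]
  have in_P: "f x y z \<in> P" "in_ivl (fst (f x y z)) x" "in_ivl (fst (snd (f x y z))) y"
      "in_ivl (snd (snd (f x y z))) z" if "x < n" "y < n" "z < n" for x y z
    using f[OF that, of "f x y z"] by (cases "f x y z", simp)+
  have bounds: "snd (fst p) \<le> n" "snd (fst (snd p)) \<le> n" "snd (snd (snd p)) \<le> n" if "p \<in> P" for p
    using P that unfolding proper_bricks_def by (cases p, force)+
  have first: "fst (fst p) < n" "in_ivl (fst p) (fst (fst p))"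
      "fst (fst (snd p)) < n" "in_ivl (fst (snd p)) (fst (fst (snd p)))"
      "fst (snd (snd p)) < n" "in_ivl (snd (snd p)) (fst (snd (snd p)))" if "p \<in> P" for p
    using P that unfolding proper_bricks_def by (cases p, force simp: proper_def in_ivl_def)+
  have eqf: "p = f x y z" if "p \<in> P" "x < n" "y < n" "z < n" "in_ivl (fst p) x"
      "in_ivl (fst (snd p)) y" "in_ivl (snd (snd p)) z" for p x y z
    using f[OF that(2-4), of p] that by (cases p) simp
  have 1: "(\<Sum>p\<in>P. len (fst p) * len (fst (snd p))) = n\<^sup>2 + (\<Sum>i<n. \<Sum>j<n. changes n (\<lambda>c. f i j c))"
  proof (rule sum_over_lines[OF fin, where Q = "\<lambda>p i j. in_ivl (fst p) i \<and> in_ivl (fst (snd p)) j"])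
    show "{p \<in> P. in_ivl (fst p) i \<and> in_ivl (fst (snd p)) j} = (\<lambda>c. f i j c) ` {..<n}"
      if "i < n" "j < n" for i j
      using in_P[OF that] eqf[OF _ that] first by (fastforce simp: image_iff)
    show "len (fst p) * len (fst (snd p)) = (\<Sum>i<n. \<Sum>j<n. of_bool (in_ivl (fst p) i \<and> in_ivl (fst (snd p)) j))"
      if "p \<in> P" for p
      by (rule len_mult_len) (rule bounds[OF that])+
  qed (rule box_classes_column[OF cl])
  have 2: "(\<Sum>p\<in>P. len (fst (snd p)) * len (snd (snd p))) = n\<^sup>2 + (\<Sum>i<n. \<Sum>j<n. changes n (\<lambda>c. f c i j))"
  proof (rule sum_over_lines[OF fin, where Q = "\<lambda>p i j. in_ivl (fst (snd p)) i \<and> in_ivl (snd (snd p)) j"])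
    show "{p \<in> P. in_ivl (fst (snd p)) i \<and> in_ivl (snd (snd p)) j} = (\<lambda>c. f c i j) ` {..<n}"
      if "i < n" "j < n" for i j
      using in_P(1,3,4)[OF _ that] eqf[OF _ _ that] first by (fastforce simp: image_iff)
    show "len (fst (snd p)) * len (snd (snd p)) = (\<Sum>i<n. \<Sum>j<n. of_bool (in_ivl (fst (snd p)) i \<and> in_ivl (snd (snd p)) j))"
      if "p \<in> P" for p
      by (rule len_mult_len) (rule bounds[OF that])+
  qed (rule box_classes_column[OF box_classes_rotate[OF box_classes_rotate[OF cl]]])
  have 3: "(\<Sum>p\<in>P. len (snd (snd p)) * len (fst p)) = n\<^sup>2 + (\<Sum>i<n. \<Sum>j<n. changes n (\<lambda>c. f j c i))"
  proof (rule sum_over_lines[OF fin, where Q = "\<lambda>p i j. in_ivl (snd (snd p)) i \<and> in_ivl (fst p) j"])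
    show "{p \<in> P. in_ivl (snd (snd p)) i \<and> in_ivl (fst p) j} = (\<lambda>c. f j c i) ` {..<n}"
      if "i < n" "j < n" for i j
      using in_P(1,2,4)[OF that(2) _ that(1)] eqf[OF _ that(2) _ that(1)] first by (fastforce simp: image_iff)
    show "len (snd (snd p)) * len (fst p) = (\<Sum>i<n. \<Sum>j<n. of_bool (in_ivl (snd (snd p)) i \<and> in_ivl (fst p) j))"
      if "p \<in> P" for p
      by (rule len_mult_len) (rule bounds[OF that])+
  qed (rule box_classes_column[OF box_classes_rotate[OF cl]])
  have "(\<Sum>b\<in>P. brick_area b) = (\<Sum>p\<in>P. 2 * (len (fst p) * len (fst (snd p)) +
      len (fst (snd p)) * len (snd (snd p)) + len (snd (snd p)) * len (fst p)))"
  proof (rule sum.cong[OF refl])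
    fix b :: brick
    show "brick_area b = 2 * (len (fst b) * len (fst (snd b)) +
      len (fst (snd b)) * len (snd (snd b)) + len (snd (snd b)) * len (fst b))" by (cases b) simp
  qed
  also have "\<dots> = 2 * ((\<Sum>p\<in>P. len (fst p) * len (fst (snd p))) +
      (\<Sum>p\<in>P. len (fst (snd p)) * len (snd (snd p))) + (\<Sum>p\<in>P. len (snd (snd p)) * len (fst p)))"
    by (simp only: sum_distrib_left[symmetric] sum.distrib)
  also have "(\<Sum>p\<in>P. len (snd (snd p)) * len (fst p)) = n\<^sup>2 + (\<Sum>i<n. \<Sum>j<n. changes n (\<lambda>c. f i c j))"
    unfolding 3 by (subst sum.swap) simp
  finally show ?thesis unfolding 1 2 iface_def by simp
qed

lemma partition_dims:
  assumes P: "proper_bricks n P"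
    and lab: "brick_labelling n P f"
    and p: "p \<in> P"
  shows "p \<in> labels3 n f \<and> dims3 n f p = brick_dims p"
proof -
  note f = brick_labellingD[OF lab]
  obtain I J K where IJ: "p = (I, J, K)" by (cases p)
  have b: "proper I" "proper J" "proper K" "snd I \<le> n" "snd J \<le> n" "snd K \<le> n"
    using P p unfolding IJ proper_bricks_def by auto
  then have c: "fst I < n" "fst J < n" "fst K < n" by (auto simp: proper_def)
  have cell: "f x y z = p \<longleftrightarrow> in_ivl I x \<and> in_ivl J y \<and> in_ivl K z" if "x < n" "y < n" "z < n" for x y z
    using f[OF that, of p] p unfolding IJ by auto
  note ip = b(1-3)[THEN in_ivl_proper]
  have "p = f (fst I) (fst J) (fst K)" using cell c ip by metis
  then have "p \<in> labels3 n f" using c unfolding labels3_def by blast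
  moreover have "{x. x < n \<and> (\<exists>y<n. \<exists>z<n. f x y z = p)} = {x. x < n \<and> in_ivl I x}"
    using cell c ip by blast
  moreover have "{y. y < n \<and> (\<exists>x<n. \<exists>z<n. f x y z = p)} = {y. y < n \<and> in_ivl J y}"
    using cell c ip by blast
  moreover have "{z. z < n \<and> (\<exists>x<n. \<exists>y<n. f x y z = p)} = {z. z < n \<and> in_ivl K z}"
    using cell c ip by blast
  ultimately show ?thesis unfolding dims3_def IJ by (simp add: card_in_ivl b)
qed

lemma partition_labelling:
  assumes n: "0 < n" and P: "cube_partition n k P"
  shows "\<exists>f :: nat \<Rightarrow> nat \<Rightarrow> nat \<Rightarrow> brick. box_classes n f \<and> card (labels3 n f) = k \<and>
    inj_on (dims3 n f) (labels3 n f) \<and> interface_area n P = iface n f \<and>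
    (\<Sum>b\<in>P. brick_area b) = 6 * n\<^sup>2 + 2 * iface n f"
proof -
  note * = P[unfolded cube_partition_iff[OF n]]
  define f where "f x y z = (THE p. p \<in> P \<and> brick_has p (x, y, z))" for x y z
  have f: "(p \<in> P \<and> brick_has p (x, y, z)) = (p = f x y z)" if "x < n" "y < n" "z < n" for x y z p
  proof -
    have "\<exists>!p. p \<in> P \<and> brick_has p (x, y, z)" using * that by blast
    then show ?thesis unfolding f_def by (metis (no_types, lifting) the_equality)
  qed
  have bl: "brick_labelling n P f" unfolding brick_labelling_def using f by blast
  have fin: "finite P" and pr: "proper_bricks n P" using * by blast+
  have "P \<subseteq> labels3 n f" using partition_dims[OF pr bl] by blast
  moreover have "labels3 n f \<subseteq> P" using f unfolding labels3_def by blast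
  ultimately have lab: "labels3 n f = P" by blast
  have "inj_on (dims3 n f) P"
    using * partition_dims[OF pr bl] unfolding inj_on_def by metis
  then show ?thesis
    using partition_classes[OF pr bl] lab * interface_area_eq[OF pr bl]
      surface_area_eq[OF fin pr bl] by blast
qed

text \<open>
  The construction for the upper bound. The tiled layer has height \<open>1\<close>, while no side of the slab
  has length \<open>1\<close> because \<open>n \<ge> 3\<close>.
\<close>

lemma slab_over_tiling:
  assumes n: "3 \<le> n" and D: "square_tiling n m D"
  shows "\<exists>P. cube_partition n (m + 1) P \<and> interface_area n P = n\<^sup>2 + wall_length n D"
proof -
  have n0: "0 < n" using n by simp
  note * = D[unfolded square_tiling_iff[OF n0]]
  have pr: "proper_rects n D" using * by blast
  define g where "g x y = (THE p. p \<in> D \<and> rect_has p (x, y))" for x y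
  have g: "(p \<in> D \<and> rect_has p (x, y)) = (p = g x y)" if "x < n" "y < n" for x y p
  proof -
    have "\<exists>!p. p \<in> D \<and> rect_has p (x, y)" using * that by blast
    then show ?thesis unfolding g_def by (metis (no_types, lifting) the_equality)
  qed
  define slab :: brick where "slab = ((0, n), (0, n), (0, n - 1))"
  define lift :: "rect \<Rightarrow> brick" where "lift = (\<lambda>(I, J). (I, J, (n - 1, n)))"
  define P where "P = insert slab (lift ` D)"
  define f where "f x y z = (if z < n - 1 then slab else lift (g x y))" for x y z
  have lift_inj: "lift p = lift q \<longleftrightarrow> p = q" for p q by (cases p; cases q) (simp add: lift_def)
  have slab_lift: "slab \<noteq> lift p" for p using n by (cases p) (simp add: slab_def lift_def)
  have dims_lift: "brick_dims (lift p) = add_mset 1 (rect_dims p)" for p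
    using n by (cases p) (simp add: lift_def len_def add_mset_commute)
  have dims_slab: "brick_dims slab = {#n, n, n - 1#}" by (simp add: slab_def len_def)
  have prP: "proper_bricks n P"
    using pr n unfolding P_def proper_bricks_def proper_rects_def
    by (auto simp: slab_def lift_def proper_def)
  have has_lift: "brick_has (lift p) (x, y, z) \<longleftrightarrow> rect_has p (x, y) \<and> z = n - 1" if "z < n" for p x y z
    using that by (cases p) (auto simp: lift_def in_ivl_def)
  have has_slab: "brick_has slab (x, y, z) \<longleftrightarrow> z < n - 1" if "x < n" "y < n" "z < n" for x y z
    using that by (auto simp: slab_def in_ivl_def)
  have f: "(p \<in> P \<and> brick_has p (x, y, z)) = (p = f x y z)" if xyz: "x < n" "y < n" "z < n" for x y z p
  proof -
    have "p \<in> P \<and> brick_has p (x, y, z) \<longleftrightarrow>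
        p = slab \<and> z < n - 1 \<or> (\<exists>r. (r \<in> D \<and> rect_has r (x, y)) \<and> p = lift r \<and> z = n - 1)"
      using has_slab[OF xyz] has_lift[OF xyz(3)] unfolding P_def by blast
    also have "\<dots> \<longleftrightarrow> p = slab \<and> z < n - 1 \<or> p = lift (g x y) \<and> z = n - 1"
      unfolding g[OF xyz(1,2)] by blast
    also have "\<dots> \<longleftrightarrow> p = f x y z" using xyz n by (auto simp: f_def)
    finally show ?thesis .
  qed
  have "cube_partition n (m + 1) P"
    unfolding cube_partition_iff[OF n0]
  proof (intro conjI ballI)
    show "finite P" using * by (simp add: P_def)
    have "card (lift ` D) = m" using * by (simp add: card_image inj_on_def lift_inj)
    then show "card P = m + 1" using * slab_lift by (subst P_def, subst card_insert_disjoint) auto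
    show "inj_on brick_dims P"
    proof -
      have "inj_on brick_dims (lift ` D)"
        using * unfolding inj_on_def by (simp add: dims_lift lift_inj)
      moreover have "brick_dims slab \<noteq> brick_dims (lift p)" for p
      proof
        assume "brick_dims slab = brick_dims (lift p)"
        then have "1 \<in># {#n, n, n - 1#}" unfolding dims_slab dims_lift by simp
        then show False using n by auto
      qed
      ultimately show ?thesis unfolding P_def inj_on_insert by blast
    qed
    show "\<exists>!p. p \<in> P \<and> brick_has p c" if "c \<in> {..<n} \<times> {..<n} \<times> {..<n}" for c
    proof -
      obtain x y z where c: "c = (x, y, z)" by (cases c)
      show ?thesis using f[of x y z] that unfolding c by auto
    qed
  qed (rule prP)
  moreover have "iface n f = n\<^sup>2 + walls n g"
  proof -
    have "walls n (\<lambda>x y. f x y h) = (if h = n - 1 then walls n g else 0)" if "h < n" for h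
      using that by (auto simp: walls_def changes_def f_def lift_inj)
    then have "(\<Sum>h<n. walls n (\<lambda>x y. f x y h)) = (\<Sum>h<n. if h = n - 1 then walls n g else 0)"
      by (intro sum.cong) auto
    also have "\<dots> = walls n g" using n0 by simp
    finally have "(\<Sum>h<n. walls n (\<lambda>x y. f x y h)) = walls n g" .
    moreover have "changes n (\<lambda>c. f i j c) = 1" for i j
    proof -
      have "{c. 0 < c \<and> c < n \<and> f i j (c - 1) \<noteq> f i j c} = {n - 1}"
        using n slab_lift slab_lift[symmetric] by (auto simp: f_def split: if_splits)
      then show ?thesis by (simp add: changes_def)
    qed
    ultimately show ?thesis unfolding iface_layers[of n f] by (simp add: power2_eq_square)
  qed
  moreover have "brick_labelling n P f" unfolding brick_labelling_def using f by blast
  moreover have "rect_labelling n D g" unfolding rect_labelling_def using g by blast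
  ultimately show ?thesis using interface_area_eq[OF prP] wall_length_eq[OF pr] by metis
qed

section \<open>The minimum interface and surface area\<close>

theorem theorem3:
  fixes n k :: nat
  assumes "n \<ge> 3" and "4 \<le> k" and "k \<le> n + 2"
    and W_defined: "\<exists>D. square_tiling n (k - 1) D"
  shows "(W_star n (k - 1) \<le> 2 * n + k - 4 \<longrightarrow>
           (\<exists>P. cube_partition n k P) \<and>
           I_min n k = n\<^sup>2 + W_star n (k - 1) \<and>
           T_min n k = 6 * n\<^sup>2 + 2 * (n\<^sup>2 + W_star n (k - 1))) \<and>
         (W_star n (k - 1) = n + k - 3 \<longrightarrow> W_star n (k - 1) \<le> 2 * n + k - 4) \<and>
         (W_star n (k - 1) = n + 2 * k - 6 \<longrightarrow> W_star n (k - 1) \<le> 2 * n + k - 4)"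
proof (intro conjI impI)
  let ?W = "W_star n (k - 1)"
  have n0: "0 < n" using \<open>n \<ge> 3\<close> by simp
  have "\<exists>w D. square_tiling n (k - 1) D \<and> wall_length n D = w" using W_defined by blast
  then have "\<exists>D. square_tiling n (k - 1) D \<and> wall_length n D = ?W"
    unfolding W_star_def by (rule LeastI_ex)
  then obtain D where D: "square_tiling n (k - 1) D" "wall_length n D = ?W" by blast
  then obtain P where P: "cube_partition n k P" "interface_area n P = n\<^sup>2 + ?W"
    using slab_over_tiling[OF \<open>n \<ge> 3\<close> D(1)] \<open>4 \<le> k\<close> by auto
  then show "\<exists>P. cube_partition n k P" by blast
  have surface: "(\<Sum>b\<in>Q. brick_area b) = 6 * n\<^sup>2 + 2 * interface_area n Q" if "cube_partition n k Q" for Q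
    using partition_labelling[OF n0 that] by metis
  assume le: "?W \<le> 2 * n + k - 4"
  have lower: "n\<^sup>2 + ?W \<le> interface_area n Q" if Q: "cube_partition n k Q" for Q
  proof -
    obtain f :: "nat \<Rightarrow> nat \<Rightarrow> nat \<Rightarrow> brick" where f: "box_classes n f" "card (labels3 n f) = k" "inj_on (dims3 n f) (labels3 n f)"
      "interface_area n Q = iface n f"
      using partition_labelling[OF n0 Q] by blast
    consider "n\<^sup>2 + 2 * n + k \<le> iface n f + 4"
      | g :: "nat \<Rightarrow> nat \<Rightarrow> brick" where "rect_classes n g" "card (labels2 n g) = k - 1" "n\<^sup>2 + walls n g \<le> iface n f"
        "inj_on (dims2 n g) (labels2 n g)"
      using iface_lower_bound[OF f(1)] f(2,3) \<open>n \<ge> 3\<close> \<open>4 \<le> k\<close> by fastforce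
    then show ?thesis
    proof cases
      case 1
      then show ?thesis using le f(4) \<open>4 \<le> k\<close> by arith
    next
      case 2
      obtain D' where "square_tiling n (k - 1) D'" "wall_length n D' = walls n g"
        using tiling_of_classes[OF n0 2(1,4)] 2(2) by auto
      then have "?W \<le> walls n g" unfolding W_star_def by (intro Least_le) blast
      then show ?thesis using 2(3) f(4) by linarith
    qed
  qed
  show "I_min n k = n\<^sup>2 + ?W"
    unfolding I_min_def
  proof (rule Least_equality)
    show "\<exists>P. cube_partition n k P \<and> interface_area n P = n\<^sup>2 + ?W" using P by blast
  qed (use lower in blast)
  show "T_min n k = 6 * n\<^sup>2 + 2 * (n\<^sup>2 + ?W)"
    unfolding T_min_def
  proof (rule Least_equality)
    show "\<exists>P. cube_partition n k P \<and> (\<Sum>b\<in>P. brick_area b) = 6 * n\<^sup>2 + 2 * (n\<^sup>2 + ?W)"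
      using P surface by metis
    show "6 * n\<^sup>2 + 2 * (n\<^sup>2 + ?W) \<le> a" if "\<exists>P. cube_partition n k P \<and> (\<Sum>b\<in>P. brick_area b) = a" for a
      using that surface lower by fastforce
  qed
qed (use assms in simp_all)

end
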